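(* Let $\mathcal{F}$ be a hereditary family of finite subsets of $\mathbb{N}$ and $M$ an infinite subset of $\mathbb{N}$. Then the following hold. [Case 1] If the family $\mathcal{F}\cap[M]^{<\omega}$ is not pointwise closed, then there exists $L\in[M]$ such that $[L]^{<\omega}\subseteq\mathcal{F}$. [Case 2] If the family $\mathcal{F}\cap[M]^{<\omega}$ is pointwise closed, then $\xi^{\mathcal{F}}_M=\sup\{s_L(\mathcal{F}):L\in[M]\}$ is a countable ordinal, and for every countable ordinal $\xi$: 2(i) if $\xi^{\mathcal{F}}_M>\xi+1$, then there exists $L\in[M]$ such that $\mathcal{A}_\xi\cap[L]^{<\omega}\subseteq\mathcal{F}$; 2(ii) if $\xi^{\mathcal{F}}_M<\xi+1$, then for every $I\in[M]$ there exists $L\in[I]$ such that $\mathcal{A}_\xi\cap[L]^{<\omega}\subseteq[\mathbb{N}]^{<\omega}\setminus\mathcal{F}$ (equivalently, such that $\mathcal{F}\cap[L]^{<\omega}\subseteq(\mathcal{A}_\xi)^{\star}\setminus\mathcal{A}_\xi$); 2(iii) if $\xi^{\mathcal{F}}_M=\xi+1$, then there exists $L\in[M]$ such that either $\mathcal{A}_\xi\cap[L]^{<\omega}\subseteq\mathcal{F}$ or $\mathcal{A}_\xi\cap[L]^{<\omega}\subseteq[\mathbb{N}]^{<\omega}\setminus\mathcal{F}$; and both alternatives may materialize (i.e. there are instances of $\mathcal{F},M,\xi$ with $\xi^{\mathcal{F}}_M=\xi+1$ in which the first alternative occurs, and instances in which the second occurs).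
   Context: $\mathbb{N}=\{1,2,3,\dots\}$. For $M\subseteq\mathbb{N}$, $[M]^{<\omega}$ is the set of all finite subsets of $M$ (including $\emptyset$) and $[M]$ the set of all infinite subsets of $M$. For $s,t\subseteq\mathbb{N}$ nonempty, $s<t$ means $\max s<\min t$; $\{n\}<\emptyset$ is considered true. Initial segments are with respect to the order of $\mathbb{N}$. For a family $\mathcal{G}$ of finite subsets of $\mathbb{N}$: $\mathcal{G}^{\star}=\{t\in[\mathbb{N}]^{<\omega}: t\text{ is an initial segment of some }s\in\mathcal{G}\}\cup\{\emptyset\}$; $\mathcal{G}$ is hereditary if every subset of an element of $\mathcal{G}$ belongs to $\mathcal{G}$. Subsets of $\mathbb{N}$ are identified with characteristic functions, and the set of all subsets of $\mathbb{N}$ carries the topology of pointwise convergence; "pointwise closed" refers to this topology. Strong Cantor-Bendixson index: let $\mathcal{G}$ be a hereditary and pointwise closed family of finite subsets of $\mathbb{N}$, $L\in[\mathbb{N}]$, and write $\mathcal{G}[N]=\mathcal{G}\cap[N]^{<\omega}$. Put $(\mathcal{G})^1_L=\{F\in\mathcal{G}[L]: F\text{ is a cluster point of }\mathcal{G}[F\cup I]\text{ for each }I\in[L]\}$, $(\mathcal{G})^{\xi+1}_L=((\mathcal{G})^{\xi}_L)^1_L$, and $(\mathcal{G})^{\xi}_L=\bigcap_{1\le\beta<\xi}(\mathcal{G})^{\beta}_L$ for limit $\xi$. The index $s_L(\mathcal{G})$ is the smallest countable ordinal $\xi\geq 1$ with $(\mathcal{G})^\xi_L=\emptyset$. It depends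 only on $\mathcal{G}\cap[L]^{<\omega}$; in Case 2, $s_L(\mathcal{F})$ for $L\in[M]$ means $s_L(\mathcal{F}\cap[M]^{<\omega})$. The complete thin Schreier system $(\mathcal{A}_\xi)_{\xi<\omega_1}$ of families of finite subsets of $\mathbb{N}$: for every non-zero countable limit ordinal $\lambda$ fix a strictly increasing sequence $(\lambda_n)_{n\ge1}$ of successor ordinals smaller than $\lambda$ with $\sup_n\lambda_n=\lambda$. Define recursively (here $p\,\omega^{\alpha}$ denotes the sum of $p$ copies of $\omega^\alpha$): (1) $\mathcal{A}_0=\{\emptyset\}$. (2) $\mathcal{A}_{\zeta+1}=\{\{n\}\cup s_1: n\in\mathbb{N},\ \{n\}<s_1,\ s_1\in\mathcal{A}_\zeta\}$. (3) $\mathcal{A}_{\omega^{\beta+1}}=\{\bigcup_{i=1}^n s_i: n=\min s_1,\ s_1<\dots<s_n,\ s_1,\dots,s_n\in\mathcal{A}_{\omega^\beta}\}$ for $\beta$ a countable ordinal. (4) $\mathcal{A}_{\omega^\lambda}=\{s: s\in\mathcal{A}_{\omega^{\lambda_n}}\text{ with }n=\min s\}$ for $\lambda$ a non-zero countable limit ordinal. (5) If $\xi$ is a limit ordinal with $\omega^\alpha<\xi<\omega^{\alpha+1}$ for some $0<\alpha<\omega_1$, write uniquely $\xi=p\,\omega^\alpha+\sum_{i=1}^m p_i\,\omega^{\alpha_i}$ with $m\ge0$, $\alpha>\alpha_1>\dots>\alpha_m>0$, natural numbers $p,p_1,\dots,p_m\ge1$ (either $p>1$, or $p=1$ and $m\ge1$).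 Then $\mathcal{A}_\xi$ is the family of all $s=s_0\cup\bigcup_{i=1}^m s_i$ with $s_m<\dots<s_1<s_0$, where $s_0=s^0_1\cup\dots\cup s^0_p$ with $s^0_1<\dots<s^0_p$ and all $s^0_j\in\mathcal{A}_{\omega^\alpha}$, and, for $1\le i\le m$, $s_i=s^i_1\cup\dots\cup s^i_{p_i}$ with $s^i_1<\dots<s^i_{p_i}$ and all $s^i_j\in\mathcal{A}_{\omega^{\alpha_i}}$. *)

theory Defs
  imports "HOL-Analysis.Analysis"
begin

section \<open>Countable ordinals\<close>

text \<open>The countable ordinals are the elements of the well-order \<open>cardSuc natLeq\<close>, whose order type
  is the first uncountable ordinal.\<close>

typedef omega1 = "Field (cardSuc natLeq)"
proof -
  have "\<not> finite (Field (cardSuc natLeq))"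
    using cardSuc_finite[OF natLeq_Card_order] by (simp add: Field_natLeq)
  then show ?thesis by (metis all_not_in_conv finite.emptyI)
qed

lemma wo_cardSuc_natLeq: "Well_order (cardSuc natLeq)"
  using cardSuc_Card_order[OF natLeq_Card_order] card_order_on_well_order_on by blast

instantiation omega1 :: wellorder
begin

definition less_eq_omega1 :: "omega1 \<Rightarrow> omega1 \<Rightarrow> bool" where
  "x \<le> y \<longleftrightarrow> (Rep_omega1 x, Rep_omega1 y) \<in> cardSuc natLeq"

definition less_omega1 :: "omega1 \<Rightarrow> omega1 \<Rightarrow> bool" where
  "x < y \<longleftrightarrow> x \<le> y \<and> \<not> y \<le> x" for x y :: omega1

instance
proof -
  let ?r = "cardSuc natLeq"
  have lin: "Linear_order ?r" and wf: "wf (?r - Id)"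
    using wo_cardSuc_natLeq by (auto simp: well_order_on_def)
  then have refl: "refl_on (Field ?r) ?r" and trans: "trans ?r" and anti: "antisym ?r"
    and tot: "total_on (Field ?r) ?r"
    by (auto simp: linear_order_on_def partial_order_on_def preorder_on_def)
  have le_refl: "x \<le> x" for x :: omega1
    using refl Rep_omega1[of x] by (auto simp: less_eq_omega1_def refl_on_def)
  have le_antisym: "x = y" if "x \<le> y" "y \<le> x" for x y :: omega1
    using that antisymD[OF anti] by (metis less_eq_omega1_def Rep_omega1_inject)
  have wf': "wf {(x, y :: omega1). x < y}"
  proof (rule wf_subset[OF wf_inv_image[OF wf, of Rep_omega1]])
    show "{(x, y). x < y} \<subseteq> inv_image (?r - Id) Rep_omega1"
      by (auto simp: inv_image_def less_omega1_def less_eq_omega1_def Rep_omega1_inject)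
  qed
  show "OFCLASS(omega1, wellorder_class)"
  proof
    fix x y z :: omega1
    show "x < y \<longleftrightarrow> x \<le> y \<and> \<not> y \<le> x" by (simp add: less_omega1_def)
    show "x \<le> x" by (rule le_refl)
    show "x \<le> z" if "x \<le> y" "y \<le> z"
      using that trans by (auto simp: less_eq_omega1_def trans_def)
    show "x = y" if "x \<le> y" "y \<le> x" by (rule le_antisym[OF that])
    show "x \<le> y \<or> y \<le> x"
      using tot Rep_omega1[of x] Rep_omega1[of y] le_refl
      by (cases "x = y") (auto simp: less_eq_omega1_def total_on_def Rep_omega1_inject)
  next
    fix P :: "omega1 \<Rightarrow> bool" and a
    assume "\<And>x. (\<And>y. y < x \<Longrightarrow> P y) \<Longrightarrow> P x"
    then show "P a" using wf_induct[OF wf', of P a] by auto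
  qed
qed

end

lemma countable_lessThan_omega1:
  includes cardinal_syntax
  shows "countable {..< x :: omega1}"
proof -
  let ?r = "cardSuc natLeq"
  have "|underS ?r (Rep_omega1 x)| <o ?r"
    by (rule card_of_underS[OF cardSuc_Card_order[OF natLeq_Card_order] Rep_omega1])
  then have "|underS ?r (Rep_omega1 x)| \<le>o natLeq"
    using cardSuc_ordLeq_ordLess[OF natLeq_Card_order card_of_Card_order] by blast
  then have "|underS ?r (Rep_omega1 x)| \<le>o |UNIV :: nat set|"
    using card_of_nat ordIso_symmetric ordLeq_ordIso_trans by blast
  then have "countable (underS ?r (Rep_omega1 x))"
    unfolding countable_def card_of_ordLeq[symmetric] by blast
  moreover have "Rep_omega1 ` {..<x} \<subseteq> underS ?r (Rep_omega1 x)"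
    by (auto simp: underS_def less_le less_eq_omega1_def Rep_omega1_inject)
  ultimately have "countable (Rep_omega1 ` {..<x})" by (rule countable_subset[rotated])
  then show ?thesis
    by (rule countable_image_inj_on) (simp add: inj_on_def Rep_omega1_inject)
qed

lemma uncountable_omega1:
  includes cardinal_syntax
  shows "\<not> countable (UNIV :: omega1 set)"
proof
  let ?r = "cardSuc natLeq"
  assume "countable (UNIV :: omega1 set)"
  then have "countable (range Rep_omega1)" by simp
  then have "countable (Field ?r)"
    by (metis Rep_omega1_cases UNIV_I countable_subset image_eqI subsetI)
  then have "|Field ?r| \<le>o |UNIV :: nat set|"
    unfolding countable_def card_of_ordLeq[symmetric] by blast
  moreover have "|Field ?r| =o ?r"
    by (rule card_of_Field_ordIso[OF cardSuc_Card_order[OF natLeq_Card_order]])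
  ultimately have "?r \<le>o natLeq"
    using card_of_nat ordIso_symmetric ordLeq_ordIso_trans ordIso_ordLeq_trans by blast
  then show False
    using cardSuc_greater[OF natLeq_Card_order] not_ordLess_ordLeq by blast
qed

lemma omega1_bdd_above:
  fixes X :: "omega1 set"
  assumes "countable X" shows "bdd_above X"
proof (rule ccontr)
  assume "\<not> bdd_above X"
  then have "(\<Union>x\<in>X. {..<x}) = UNIV" by (force simp: bdd_above_def not_le)
  moreover have "countable (\<Union>x\<in>X. {..<x})"
    using assms by (intro countable_UN countable_lessThan_omega1)
  ultimately show False using uncountable_omega1 by simp
qed

lemma omega1_gt_ex: "\<exists>y. x < (y :: omega1)"
proof (rule ccontr)
  assume "\<nexists>y. x < y"
  then have "UNIV = insert x {..<x}" by (auto simp: not_less order.order_iff_strict)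
  then show False using countable_lessThan_omega1[of x] uncountable_omega1
    by (metis countable_insert)
qed

instantiation omega1 :: conditionally_complete_linorder
begin

definition sup_omega1 :: "omega1 \<Rightarrow> omega1 \<Rightarrow> omega1" where "sup_omega1 = (max :: omega1 \<Rightarrow> _)"
definition inf_omega1 :: "omega1 \<Rightarrow> omega1 \<Rightarrow> omega1" where "inf_omega1 = (min :: omega1 \<Rightarrow> _)"
definition Sup_omega1 :: "omega1 set \<Rightarrow> omega1" where "Sup X = (LEAST u :: omega1. \<forall>x\<in>X. x \<le> u)"
definition Inf_omega1 :: "omega1 set \<Rightarrow> omega1" where "Inf X = (LEAST u :: omega1. u \<in> X)"

instance
proof
  fix x z :: omega1 and X :: "omega1 set"
  show "Inf X \<le> x" if "x \<in> X" "bdd_below X"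
    unfolding Inf_omega1_def using that by (intro Least_le)
  show "z \<le> Inf X" if "X \<noteq> {}" "\<And>x. x \<in> X \<Longrightarrow> z \<le> x"
    unfolding Inf_omega1_def using that by (metis LeastI ex_in_conv)
  show "x \<le> Sup X" if "x \<in> X" "bdd_above X"
  proof -
    from that(2) obtain u where "\<forall>x\<in>X. x \<le> u" by (auto simp: bdd_above_def)
    then have "\<forall>x\<in>X. x \<le> Sup X" unfolding Sup_omega1_def by (rule LeastI)
    then show ?thesis using that(1) by blast
  qed
  show "Sup X \<le> z" if "X \<noteq> {}" "\<And>x. x \<in> X \<Longrightarrow> x \<le> z"
    unfolding Sup_omega1_def using that by (intro Least_le) blast
qed (auto simp: sup_omega1_def inf_omega1_def)

end

definition osuc :: "omega1 \<Rightarrow> omega1" where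
  "osuc x = (LEAST y. x < y)"

definition opred :: "omega1 \<Rightarrow> omega1" where
  "opred x = (THE y. x = osuc y)"

definition is_succ :: "omega1 \<Rightarrow> bool" where
  "is_succ x \<longleftrightarrow> (\<exists>y. x = osuc y)"

lemma less_osuc [simp]: "x < osuc x"
  unfolding osuc_def using omega1_gt_ex by (rule LeastI_ex)

lemma osuc_le_iff: "osuc x \<le> y \<longleftrightarrow> x < y"
  by (metis Least_le less_osuc less_le_trans osuc_def)

lemma less_osuc_iff: "x < osuc y \<longleftrightarrow> x \<le> y"
  by (metis osuc_le_iff not_le)

lemma osuc_inject [simp]: "osuc x = osuc y \<longleftrightarrow> x = y"
  by (metis less_osuc_iff order.antisym order.refl)

lemma opred_osuc [simp]: "opred (osuc x) = x"
  by (simp add: opred_def)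

lemma is_succ_osuc [simp]: "is_succ (osuc x)"
  by (auto simp: is_succ_def)

lemma osuc_opred: "is_succ x \<Longrightarrow> osuc (opred x) = x"
  by (auto simp: is_succ_def)

lemma opred_less: "is_succ x \<Longrightarrow> opred x < x"
  by (auto simp: is_succ_def)

instantiation omega1 :: "{zero, one}"
begin

definition zero_omega1 :: omega1 where "0 = (LEAST x :: omega1. True)"
definition one_omega1 :: omega1 where "1 = osuc 0"

instance ..

end

lemma omega1_zero_le [simp]: "0 \<le> (x :: omega1)"
  unfolding zero_omega1_def by (rule Least_le) simp

lemma omega1_not_less_zero [simp]: "\<not> (x :: omega1) < 0"
  by (simp add: not_less)

lemma osuc_neq_zero [simp]: "osuc x \<noteq> 0" "0 \<noteq> osuc x"
  by (metis less_osuc omega1_not_less_zero)+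

lemma not_is_succ_zero [simp]: "\<not> is_succ 0"
  by (auto simp: is_succ_def)

definition is_limit :: "omega1 \<Rightarrow> bool" where
  "is_limit x \<longleftrightarrow> x \<noteq> 0 \<and> \<not> is_succ x"

lemma omega1_cases [case_names zero succ limit]:
  obtains "x = 0" | y where "x = osuc y" | "is_limit x"
  by (auto simp: is_limit_def is_succ_def)

lemma is_limit_osuc_less: "is_limit x \<Longrightarrow> y < x \<Longrightarrow> osuc y < x"
  by (metis is_limit_def is_succ_osuc order.order_iff_strict osuc_le_iff)

subsection \<open>Ordinal addition and powers of \<open>\<omega>\<close>\<close>

function oadd :: "omega1 \<Rightarrow> omega1 \<Rightarrow> omega1" where
  "oadd x y = (if y = 0 then x else if is_succ y then osuc (oadd x (opred y))
     else (SUP z\<in>{..<y}. oadd x z))"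
  by pat_completeness auto
termination
  by (relation "inv_image {(x, y :: omega1). x < y} snd")
     (auto intro: opred_less wf)

declare oadd.simps [simp del]

instantiation omega1 :: plus
begin

definition plus_omega1 :: "omega1 \<Rightarrow> omega1 \<Rightarrow> omega1" where "x + y = oadd x y"

instance ..

end

lemma oplus_zero: "x + 0 = (x :: omega1)"
  by (simp add: plus_omega1_def oadd.simps)

lemma oplus_osuc: "x + osuc y = osuc (x + y)"
  by (simp add: plus_omega1_def oadd.simps[of x "osuc y"])

lemma oplus_limit: "is_limit y \<Longrightarrow> x + y = (SUP z\<in>{..<y}. x + z)"
  by (simp add: plus_omega1_def oadd.simps[of x y] is_limit_def)

lemma oplus_one: "x + 1 = osuc x"
  by (simp add: one_omega1_def oplus_osuc oplus_zero)

lemma bdd_above_image_lessThan: "bdd_above (f ` {..< x :: omega1})" for f :: "omega1 \<Rightarrow> omega1"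
  by (intro omega1_bdd_above countable_image countable_lessThan_omega1)

lemma lessThan_omega1_nonempty: "is_limit x \<Longrightarrow> {..<x} \<noteq> {}"
  by (metis emptyE is_limit_def lessThan_iff omega1_zero_le order.order_iff_strict)

lemma SUP_lessThan_limit:
  assumes "is_limit x" shows "(SUP y\<in>{..<x}. y) = x"
proof (rule antisym)
  show "(SUP y\<in>{..<x}. y) \<le> x"
    using lessThan_omega1_nonempty[OF assms] by (intro cSUP_least) auto
  show "x \<le> (SUP y\<in>{..<x}. y)"
  proof (rule ccontr)
    assume "\<not> x \<le> (SUP y\<in>{..<x}. y)"
    then have "osuc (SUP y\<in>{..<x}. y) < x"
      using is_limit_osuc_less[OF assms] by (simp add: not_le)
    then have "osuc (SUP y\<in>{..<x}. y) \<le> (SUP y\<in>{..<x}. y)"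
      by (intro cSUP_upper bdd_above_image_lessThan) simp
    then show False by (metis less_osuc not_le)
  qed
qed

lemma oplus_strict_mono: "y < z \<Longrightarrow> x + y < x + (z :: omega1)"
proof (induction z rule: less_induct)
  case (less z)
  show ?case
  proof (cases z rule: omega1_cases)
    case zero
    then show ?thesis using less.prems by simp
  next
    case (succ w)
    then show ?thesis using less by (metis less_osuc less_osuc_iff oplus_osuc order.strict_trans
          order.order_iff_strict)
  next
    case limit
    then have "x + osuc y \<le> x + z"
      unfolding oplus_limit[OF limit] using is_limit_osuc_less[OF limit less.prems]
      by (intro cSUP_upper bdd_above_image_lessThan) simp
    then show ?thesis by (simp add: oplus_osuc osuc_le_iff)
  qed
qed

lemma oplus_mono: "y \<le> z \<Longrightarrow> x + y \<le> x + (z :: omega1)"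
  using oplus_strict_mono by (auto simp: order.order_iff_strict)

lemma is_limit_oplus:
  assumes "is_limit y" shows "is_limit (x + y)"
  unfolding is_limit_def
proof
  have "x + 0 < x + y"
    using assms by (intro oplus_strict_mono) (auto simp: is_limit_def less_le)
  then show "x + y \<noteq> 0" by auto
  show "\<not> is_succ (x + y)"
  proof
    assume "is_succ (x + y)"
    then obtain w where w: "x + y = osuc w" by (auto simp: is_succ_def)
    then have "w < (SUP z\<in>{..<y}. x + z)"
      by (metis less_osuc oplus_limit[OF assms])
    then obtain z where z: "z < y" "w < x + z"
      using less_cSUP_iff[OF lessThan_omega1_nonempty[OF assms] bdd_above_image_lessThan] by auto
    then have "osuc w \<le> x + z" by (simp add: osuc_le_iff)
    also have "\<dots> < x + y" by (rule oplus_strict_mono[OF z(1)])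
    finally show False using w by simp
  qed
qed

instance omega1 :: monoid_add
proof
  fix x y z :: omega1
  show "x + 0 = x" by (rule oplus_zero)
  show "0 + x = x"
  proof (induction x rule: less_induct)
    case (less x)
    show ?case
    proof (cases x rule: omega1_cases)
      case limit
      then have "0 + x = (SUP z\<in>{..<x}. z)"
        using less by (simp add: oplus_limit cong: image_cong_simp)
      then show ?thesis using SUP_lessThan_limit[OF limit] by simp
    qed (use less in \<open>auto simp: oplus_zero oplus_osuc\<close>)
  qed
  show "x + y + z = x + (y + z)"
  proof (induction z rule: less_induct)
    case (less z)
    show ?case
    proof (cases z rule: omega1_cases)
      case limit
      have yz: "is_limit (y + z)" by (rule is_limit_oplus[OF limit])
      have "x + y + z = (SUP w\<in>{..<z}. x + (y + w))"
        using less by (simp add: oplus_limit[OF limit] cong: image_cong_simp)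
      also have "\<dots> = (SUP v\<in>{..<y + z}. x + v)"
      proof (rule antisym)
        show "(SUP w\<in>{..<z}. x + (y + w)) \<le> (SUP v\<in>{..<y + z}. x + v)"
          by (intro cSUP_least lessThan_omega1_nonempty limit cSUP_upper bdd_above_image_lessThan)
             (simp add: oplus_strict_mono)
        show "(SUP v\<in>{..<y + z}. x + v) \<le> (SUP w\<in>{..<z}. x + (y + w))"
        proof (intro cSUP_least lessThan_omega1_nonempty yz)
          fix v assume "v \<in> {..<y + z}"
          then have "v < (SUP w\<in>{..<z}. y + w)" by (simp add: oplus_limit[OF limit])
          then obtain w where w: "w < z" "v < y + w"
            using less_cSUP_iff[OF lessThan_omega1_nonempty[OF limit] bdd_above_image_lessThan]
            by auto
          then have "x + v \<le> x + (y + w)" by (intro oplus_mono) simp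
          also have "\<dots> \<le> (SUP w\<in>{..<z}. x + (y + w))"
            using w by (intro cSUP_upper bdd_above_image_lessThan) simp
          finally show "x + v \<le> (SUP w\<in>{..<z}. x + (y + w))" .
        qed
      qed
      also have "\<dots> = x + (y + z)" by (simp add: oplus_limit[OF yz])
      finally show ?thesis .
    qed (use less in \<open>auto simp: oplus_zero oplus_osuc\<close>)
  qed
qed

text \<open>The sum \<open>x + \<dots> + x\<close> of \<open>n\<close> copies of \<open>x\<close>, i.e.\ the ordinal product of \<open>x\<close> and \<open>n\<close> that is
  usually written with \<open>n\<close> on the right.\<close>

definition ocopies :: "nat \<Rightarrow> omega1 \<Rightarrow> omega1" where
  "ocopies n x = sum_list (replicate n x)"

function omega_pow :: "omega1 \<Rightarrow> omega1" where
  "omega_pow x = (if x = 0 then 1 else if is_succ x then (SUP n. ocopies n (omega_pow (opred x)))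
     else (SUP y\<in>{..<x}. omega_pow y))"
  by pat_completeness auto
termination
  by (relation "{(x, y :: omega1). x < y}") (auto intro: opred_less wf)

declare omega_pow.simps [simp del]

lemma omega_pow_zero: "omega_pow 0 = 1"
  by (simp add: omega_pow.simps)

lemma omega_pow_osuc: "omega_pow (osuc x) = (SUP n. ocopies n (omega_pow x))"
  by (simp add: omega_pow.simps[of "osuc x"])

lemma omega_pow_limit: "is_limit x \<Longrightarrow> omega_pow x = (SUP y\<in>{..<x}. omega_pow y)"
  by (simp add: omega_pow.simps[of x] is_limit_def)

section \<open>Families of finite sets of positive integers\<close>

abbreviation posnats :: "nat set" where
  "posnats \<equiv> {1..}"

definition inf_subsets :: "nat set \<Rightarrow> nat set set" where
  "inf_subsets M = {L. L \<subseteq> M \<and> infinite L}"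

definition hereditary :: "nat set set \<Rightarrow> bool" where
  "hereditary G \<longleftrightarrow> (\<forall>s\<in>G. \<forall>t. t \<subseteq> s \<longrightarrow> t \<in> G)"

text \<open>With the convention that the relation holds whenever one of the sets is empty.\<close>

definition block_less :: "nat set \<Rightarrow> nat set \<Rightarrow> bool" where
  "block_less s t \<longleftrightarrow> (\<forall>x\<in>s. \<forall>y\<in>t. x < y)"

definition initial_segment :: "nat set \<Rightarrow> nat set \<Rightarrow> bool" where
  "initial_segment t s \<longleftrightarrow> t \<subseteq> s \<and> (\<forall>x\<in>s. \<forall>y\<in>t. x \<le> y \<longrightarrow> x \<in> t)"

definition star :: "nat set set \<Rightarrow> nat set set" where
  "star G = {t \<in> Fpow posnats. \<exists>s\<in>G. initial_segment t s} \<union> {{}}"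

text \<open>Characteristic functions live in \<open>nat \<Rightarrow> bool\<close>, which carries the product of the discrete
  topologies.\<close>

definition chi :: "nat set \<Rightarrow> nat \<Rightarrow> bool" where
  "chi s = (\<lambda>n. n \<in> s)"

definition pointwise_closed :: "nat set set \<Rightarrow> bool" where
  "pointwise_closed G \<longleftrightarrow> closed (chi ` G)"

definition cluster_point :: "nat set \<Rightarrow> nat set set \<Rightarrow> bool" where
  "cluster_point s G \<longleftrightarrow> chi s islimpt (chi ` G)"

subsection \<open>The strong Cantor-Bendixson index\<close>

definition scb_step :: "nat set \<Rightarrow> nat set set \<Rightarrow> nat set set" where
  "scb_step L G = {s \<in> G \<inter> Fpow L. \<forall>I\<in>inf_subsets L. cluster_point s (G \<inter> Fpow (s \<union> I))}"

text \<open>The derivatives are indexed by the ordinals \<open>\<ge> 1\<close>; the value at \<open>0\<close> is auxiliary.\<close>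

function scb_deriv :: "nat set \<Rightarrow> nat set set \<Rightarrow> omega1 \<Rightarrow> nat set set" where
  "scb_deriv L G x = (if x = 0 then G else if is_succ x then scb_step L (scb_deriv L G (opred x))
     else (\<Inter>y\<in>{1..<x}. scb_deriv L G y))"
  by pat_completeness auto
termination
  by (relation "inv_image {(x, y :: omega1). x < y} (\<lambda>(L, G, x). x)")
     (auto intro: opred_less wf)

declare scb_deriv.simps [simp del]

lemma scb_deriv_one: "scb_deriv L G 1 = scb_step L G"
  by (simp add: scb_deriv.simps[of L G "osuc 0"] scb_deriv.simps[of L G 0] one_omega1_def)

lemma scb_deriv_add_one: "scb_deriv L G (x + 1) = scb_step L (scb_deriv L G x)"
  by (simp add: scb_deriv.simps[of L G "osuc x"] oplus_one)

lemma scb_deriv_limit: "is_limit x \<Longrightarrow> scb_deriv L G x = (\<Inter>y\<in>{1..<x}. scb_deriv L G y)"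
  by (simp add: scb_deriv.simps[of L G x] is_limit_def)

definition scb_index :: "nat set \<Rightarrow> nat set set \<Rightarrow> omega1" where
  "scb_index L G = (LEAST x. 1 \<le> x \<and> scb_deriv L G x = {})"

definition scb_sup :: "nat set \<Rightarrow> nat set set \<Rightarrow> omega1" where
  "scb_sup M F = (SUP L\<in>inf_subsets M. scb_index L (F \<inter> Fpow M))"

subsection \<open>The complete thin Schreier system\<close>

definition ladder_system :: "(omega1 \<Rightarrow> nat \<Rightarrow> omega1) \<Rightarrow> bool" where
  "ladder_system lam \<longleftrightarrow> (\<forall>x. is_limit x \<longrightarrow>
     strict_mono_on {1..} (lam x) \<and>
     (\<forall>n\<ge>1. is_succ (lam x n) \<and> lam x n < x) \<and>
     (SUP n\<in>{1..}. lam x n) = x)"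

definition block_seq :: "nat \<Rightarrow> (nat \<Rightarrow> nat set) \<Rightarrow> bool" where
  "block_seq n S \<longleftrightarrow> (\<forall>i j. 1 \<le> i \<and> i < j \<and> j \<le> n \<longrightarrow> block_less (S i) (S j))"

text \<open>\<open>schreier_mem lam x s\<close> says that \<open>s\<close> belongs to the family with index \<open>x\<close>. The
  recursion on \<open>x\<close> is expressed as an inductive predicate: every index is covered by exactly one
  rule, and membership at \<open>x\<close> refers only to smaller indices. In the last rule the leading term of
  the Cantor normal form of \<open>x\<close> has index \<open>0\<close>, and the blocks \<open>s\<^sub>m < \<dots> < s\<^sub>1 < s\<^sub>0\<close> are
  \<open>s\<^sub>i = S i 1 \<union> \<dots> \<union> S i (p i)\<close>.\<close>

inductive schreier_mem :: "(omega1 \<Rightarrow> nat \<Rightarrow> omega1) \<Rightarrow> omega1 \<Rightarrow> nat set \<Rightarrow> bool"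
  for lam :: "omega1 \<Rightarrow> nat \<Rightarrow> omega1" where
  zero: "schreier_mem lam 0 {}"
| succ: "schreier_mem lam (z + 1) ({n} \<union> s)"
    if "1 \<le> n" "block_less {n} s" "schreier_mem lam z s"
| pow_succ: "schreier_mem lam (omega_pow (b + 1)) (\<Union>i\<in>{1..n}. S i)"
    if "1 \<le> n" "n = Min (S 1)" "block_seq n S"
      "\<forall>i\<in>{1..n}. schreier_mem lam (omega_pow b) (S i)"
| pow_limit: "schreier_mem lam (omega_pow l) s"
    if "is_limit l" "s \<noteq> {}" "n = Min s" "schreier_mem lam (omega_pow (lam l n)) s"
| sum: "schreier_mem lam x (\<Union>i\<in>{0..m}. \<Union>j\<in>{1..p i}. S i j)"
    if "is_limit x" "0 < a 0" "omega_pow (a 0) < x" "x < omega_pow (a 0 + 1)"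
      "x = sum_list (map (\<lambda>i. ocopies (p i) (omega_pow (a i))) [0..<m + 1])"
      "\<forall>i<m. a (i + 1) < a i" "\<forall>i\<le>m. 0 < a i \<and> 1 \<le> p i"
      "\<forall>i\<le>m. block_seq (p i) (S i)"
      "\<forall>i k. i < k \<and> k \<le> m \<longrightarrow> block_less (\<Union>j\<in>{1..p k}. S k j) (\<Union>j\<in>{1..p i}. S i j)"
      "\<forall>i\<le>m. \<forall>j\<in>{1..p i}. schreier_mem lam (omega_pow (a i)) (S i j)"

definition schreier :: "(omega1 \<Rightarrow> nat \<Rightarrow> omega1) \<Rightarrow> omega1 \<Rightarrow> nat set set" where
  "schreier lam x = {s. schreier_mem lam x s}"

end

theory Submission
  imports Defs
begin

text \<open>The heart of the matter is that for \<open>x > 0\<close> the section of the Schreier family with index \<open>x\<close> at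
  a possible minimum \<open>n\<close> is, beyond \<open>n\<close>, the Schreier family with some smaller index \<open>sec x n\<close>,
  where \<open>sec x n\<close> tends to \<open>x\<close> if \<open>x\<close> is a limit: in the Cantor normal form of \<open>x\<close> the last power
  \<open>\<omega>\<^sup>a\<close>, which governs the first block of a set, is replaced by a smaller ordinal. By induction
  along \<open>sec\<close>, the Schreier families are complete and have the Ramsey property (diagonalisation).
  For hereditary families the strong Cantor-Bendixson derivative keeps those \<open>s\<close> for which
  \<open>insert k s\<close> stays in the family for all but finitely many \<open>k\<close>, so it also commutes with sections,
  and induction along \<open>sec\<close> compares it with the Schreier families: if the family contains the
  Schreier family \<open>x\<close> on \<open>L\<close>, then \<open>{}\<close> survives \<open>x\<close> derivatives, and if it is disjoint from it,
  then \<open>{}\<close> does not survive \<open>x + 1\<close> derivatives. The Ramsey property yields one of these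
  alternatives on some infinite subset.\<close>

section \<open>Ordinal arithmetic\<close>

lemma is_limit_pos: "is_limit x \<Longrightarrow> 0 < x"
  by (metis is_limit_def omega1_zero_le order.order_iff_strict)

lemma pos_iff_neq_zero: "0 < x \<longleftrightarrow> x \<noteq> (0::omega1)"
  by (metis omega1_not_less_zero omega1_zero_le order.order_iff_strict)

lemma is_limit_not_succ: "is_limit x \<Longrightarrow> x \<noteq> y + 1"
  by (auto simp: is_limit_def oplus_one)

lemma oplus_left_cancel: "x + y = x + z \<longleftrightarrow> y = (z::omega1)"
  by (metis linorder_less_linear oplus_strict_mono order_less_irrefl)

text \<open>Only the weak inequality survives on this side: a strict increase of the left summand
  can be absorbed, as in \<open>0 + \<omega> = 1 + \<omega>\<close>.\<close>

lemma oplus_mono_left: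
  assumes "x \<le> y" shows "x + z \<le> y + (z::omega1)"
proof (induction z rule: less_induct)
  case (less z)
  show ?case
  proof (cases z rule: omega1_cases)
    case (succ w)
    then show ?thesis using less[of w] by (simp add: oplus_osuc osuc_le_iff less_osuc_iff)
  next
    case limit
    show ?thesis unfolding oplus_limit[OF limit]
    proof (rule cSUP_mono)
      show "{..<z} \<noteq> {}" by (rule lessThan_omega1_nonempty[OF limit])
      show "bdd_above ((+) y ` {..<z})" by (rule bdd_above_image_lessThan)
    qed (use less in auto)
  qed (use assms in simp)
qed

lemma le_oplus_right: "x \<le> x + (y::omega1)"
  using oplus_mono[of 0 y x] by simp

lemma le_oplus_left: "y \<le> x + (y::omega1)"
  using oplus_mono_left[of 0 x y] by simp

text \<open>Left subtraction. The least \<open>z\<close> with \<open>y \<le> x + z\<close> gives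
  equality: at 0 by assumption, at a successor because \<open>x + w < y\<close> for its predecessor
  \<open>w\<close>, at a limit by continuity of addition.\<close>

lemma oplus_diff_ex:
  assumes "x \<le> y" shows "\<exists>z. y = x + (z::omega1)"
proof -
  let ?z = "LEAST z. y \<le> x + z"
  have z: "y \<le> x + ?z" by (rule LeastI[of _ y]) (rule le_oplus_left)
  have least: "x + w < y" if "w < ?z" for w
    using not_less_Least[OF that] by simp
  show ?thesis
  proof (cases ?z rule: omega1_cases)
    case zero
    then show ?thesis using z assms by (intro exI[of _ 0]) simp
  next
    case (succ w)
    then have "osuc (x + w) \<le> y" using least[of w] by (simp add: osuc_le_iff)
    then show ?thesis using z succ oplus_osuc by (intro exI[of _ "osuc w"]) simp
  next
    case limit
    have "x + ?z \<le> y" unfolding oplus_limit[OF limit]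
      using lessThan_omega1_nonempty[OF limit] least by (intro cSUP_least) (auto intro: less_imp_le)
    then show ?thesis using z by (intro exI[of _ ?z]) simp
  qed
qed

section \<open>Finite multiples and powers of \<omega>\<close>

lemma ocopies_0 [simp]: "ocopies 0 x = 0"
  by (simp add: ocopies_def)

lemma ocopies_Suc: "ocopies (Suc n) x = x + ocopies n x"
  by (simp add: ocopies_def)

lemma ocopies_Suc_right: "ocopies (Suc n) x = ocopies n x + x"
  by (induction n) (simp_all add: ocopies_Suc add.assoc[symmetric])

lemma ocopies_mono: "m \<le> n \<Longrightarrow> ocopies m x \<le> ocopies n x"
  by (induction rule: dec_induct) (auto simp: ocopies_Suc_right intro: order.trans le_oplus_right)

lemma less_omega_pow_osuc_iff: "y < omega_pow (osuc a) \<longleftrightarrow> (\<exists>n. y < ocopies n (omega_pow a))"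
  unfolding omega_pow_osuc by (subst less_cSUP_iff) (auto intro: omega1_bdd_above)

lemma omega_pow_pos [simp]: "0 < omega_pow a"
proof (induction a rule: less_induct)
  case (less a)
  show ?case
  proof (cases a rule: omega1_cases)
    case zero
    then show ?thesis by (simp add: omega_pow_zero one_omega1_def)
  next
    case (succ b)
    then have "0 < ocopies 1 (omega_pow b)" using less[of b] by (simp add: ocopies_Suc)
    then show ?thesis using succ less_omega_pow_osuc_iff by blast
  next
    case limit
    then have "0 < omega_pow 0" using less[of 0] is_limit_pos by simp
    also have "\<dots> \<le> omega_pow a" unfolding omega_pow_limit[OF limit]
      using limit is_limit_pos by (intro cSUP_upper bdd_above_image_lessThan) auto
    finally show ?thesis .
  qed
qed

lemma omega_pow_neq_zero [simp]: "omega_pow a \<noteq> 0"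
  using omega_pow_pos[of a] by (simp add: pos_iff_neq_zero del: omega_pow_pos)

lemma ocopies_less_omega_pow: "ocopies n (omega_pow a) < omega_pow (osuc a)"
proof -
  have "ocopies n (omega_pow a) < ocopies (Suc n) (omega_pow a)"
    unfolding ocopies_Suc_right using oplus_strict_mono[of 0 "omega_pow a"] by simp
  then show ?thesis using less_omega_pow_osuc_iff by blast
qed

lemma omega_pow_less_osuc: "omega_pow a < omega_pow (osuc a)"
  using ocopies_less_omega_pow[of 1 a] by (simp add: ocopies_Suc)

lemma omega_pow_strict_mono: "a < b \<Longrightarrow> omega_pow a < omega_pow b"
proof (induction b rule: less_induct)
  case (less b)
  show ?case
  proof (cases b rule: omega1_cases)
    case zero
    then show ?thesis using less.prems by simp
  next
    case (succ c)
    then show ?thesis using less omega_pow_less_osuc[of c]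
      by (metis less_osuc less_osuc_iff order.order_iff_strict order.strict_trans)
  next
    case limit
    then have "omega_pow (osuc a) \<le> omega_pow b" unfolding omega_pow_limit[OF limit]
      using is_limit_osuc_less[OF limit less.prems]
      by (intro cSUP_upper bdd_above_image_lessThan) auto
    then show ?thesis using omega_pow_less_osuc[of a] by simp
  qed
qed

lemma omega_pow_less_iff [simp]: "omega_pow a < omega_pow b \<longleftrightarrow> a < b"
  by (metis linorder_less_linear omega_pow_strict_mono order.asym order_less_irrefl)

lemma omega_pow_le_iff [simp]: "omega_pow a \<le> omega_pow b \<longleftrightarrow> a \<le> b"
  by (metis linorder_not_le omega_pow_less_iff)

lemma omega_pow_eq_iff [simp]: "omega_pow a = omega_pow b \<longleftrightarrow> a = b"
  by (metis linorder_less_linear omega_pow_strict_mono order_less_irrefl)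

lemma is_limitI: "0 < x \<Longrightarrow> (\<And>y. y < x \<Longrightarrow> osuc y < x) \<Longrightarrow> is_limit x"
  by (metis is_limit_def is_succ_def less_osuc order_less_irrefl)

lemma less_omega_pow_limit_iff:
  "is_limit a \<Longrightarrow> y < omega_pow a \<longleftrightarrow> (\<exists>b<a. y < omega_pow b)"
  unfolding omega_pow_limit
  by (subst less_cSUP_iff[OF lessThan_omega1_nonempty bdd_above_image_lessThan]) auto

text \<open>Anything below the power lies below a finite multiple of the preceding power, or below a
  smaller power if the exponent is a limit. That bound is itself strictly smaller, which leaves room
  for a successor.\<close>

lemma is_limit_omega_pow: "0 < a \<Longrightarrow> is_limit (omega_pow a)"
proof (rule is_limitI)
  fix y assume a: "0 < a" and y: "y < omega_pow a"
  show "osuc y < omega_pow a"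
  proof (cases a rule: omega1_cases)
    case zero
    then show ?thesis using a by simp
  next
    case (succ b)
    then obtain n where "y < ocopies n (omega_pow b)"
      using y less_omega_pow_osuc_iff by auto
    then have "osuc y \<le> ocopies n (omega_pow b)" by (simp add: osuc_le_iff)
    then show ?thesis using ocopies_less_omega_pow[of n b] succ by simp
  next
    case limit
    then obtain b where "b < a" "y < omega_pow b"
      using y less_omega_pow_limit_iff by auto
    then have "osuc y \<le> omega_pow b" by (simp add: osuc_le_iff)
    also have "\<dots> < omega_pow a" using \<open>b < a\<close> by simp
    finally show ?thesis .
  qed
qed simp

section \<open>Cantor normal form\<close>

text \<open>Coefficients are encoded by repetition of exponents. Only nonincreasing lists are normal
  forms, so sortedness is assumed wherever uniqueness matters.\<close>

definition cnf :: "omega1 list \<Rightarrow> omega1" where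
  "cnf xs = sum_list (map omega_pow xs)"

lemma cnf_simps [simp]:
  "cnf [] = 0" "cnf (a # xs) = omega_pow a + cnf xs" "cnf (xs @ ys) = cnf xs + cnf ys"
  by (auto simp: cnf_def)

lemma cnf_replicate: "cnf (replicate n a) = ocopies n (omega_pow a)"
  by (simp add: cnf_def ocopies_def)

lemma cnf_le_ocopies: "\<forall>c\<in>set xs. c \<le> a \<Longrightarrow> cnf xs \<le> ocopies (length xs) (omega_pow a)"
proof (induction xs)
  case (Cons c xs)
  then have "omega_pow c + cnf xs \<le> omega_pow a + ocopies (length xs) (omega_pow a)"
    by (intro order.trans[OF oplus_mono_left oplus_mono]) auto
  then show ?case by (simp add: ocopies_Suc)
qed simp

lemma cnf_less_omega_pow_osuc: "\<forall>c\<in>set xs. c \<le> a \<Longrightarrow> cnf xs < omega_pow (osuc a)"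
  using cnf_le_ocopies[of xs a] ocopies_less_omega_pow order.strict_trans1 by blast

lemma cnf_less_omega_pow:
  assumes "sorted_wrt (\<ge>) xs" "\<forall>c\<in>set xs. c < a" shows "cnf xs < omega_pow a"
proof (cases xs)
  case (Cons c ys)
  then have "cnf xs < omega_pow (osuc c)"
    using assms(1) by (intro cnf_less_omega_pow_osuc) auto
  also have "\<dots> \<le> omega_pow a" using assms Cons by (simp add: osuc_le_iff)
  finally show ?thesis .
qed simp

lemma cnf_eq_zero_iff [simp]: "cnf xs = 0 \<longleftrightarrow> xs = []"
proof (cases xs)
  case (Cons a ys)
  then have "0 < cnf xs" using less_le_trans[OF omega_pow_pos le_oplus_right] by simp
  then show ?thesis using Cons by (simp only: less_le) auto
qed simp

text \<open>The leading exponent \<open>a\<close> can be read off from the value, which lies between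
  \<open>omega_pow a\<close> and \<open>omega_pow (osuc a)\<close>. The leading powers then cancel
  on the left.\<close>

lemma cnf_inject:
  "sorted_wrt (\<ge>) xs \<Longrightarrow> sorted_wrt (\<ge>) ys \<Longrightarrow> cnf xs = cnf ys \<Longrightarrow> xs = ys"
proof (induction xs arbitrary: ys)
  case Nil
  then show ?case
    using cnf_eq_zero_iff[of ys] by simp
next
  case (Cons a xs)
  show ?case
  proof (cases ys)
    case Nil
    then show ?thesis 
      using Cons.prems cnf_eq_zero_iff[of "a # xs"] by (simp del: cnf_eq_zero_iff)
  next
    case (Cons b zs)
    have "cnf (a # xs) < omega_pow (osuc a)" "cnf (b # zs) < omega_pow (osuc b)"
      using Cons.prems(1,2) unfolding Cons by (intro cnf_less_omega_pow_osuc; simp)+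
    moreover have "omega_pow a \<le> cnf (a # xs)" "omega_pow b \<le> cnf (b # zs)"
      by (simp_all add: le_oplus_right)
    ultimately have "omega_pow a < omega_pow (osuc b)" "omega_pow b < omega_pow (osuc a)"
      using Cons.prems(3) unfolding Cons by (metis order.strict_trans1)+
    then have "a = b" by (simp add: less_osuc_iff)
    then show ?thesis using Cons.IH[of zs] Cons.prems Cons by (simp add: oplus_left_cancel)
  qed
qed

text \<open>A strictly increasing self-map of a well-order never decreases: at a counterexample
  \<open>a\<close>, the hypothesis for the smaller \<open>omega_pow a\<close> contradicts strict
  monotonicity.\<close>

lemma omega_pow_ge: "a \<le> omega_pow a"
proof (induction a rule: less_induct)
  case (less a)
  show ?case
  proof (rule ccontr)
    assume "\<not> a \<le> omega_pow a"
    then have "omega_pow a < a" by simp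
    then have "omega_pow a \<le> omega_pow (omega_pow a)" by (rule less)
    then show False using \<open>omega_pow a < a\<close> by simp
  qed
qed

text \<open>The least \<open>c\<close> with \<open>x < omega_pow c\<close> is not 0 because
  \<open>x\<close> is positive, and not a limit because the powers are continuous there. Its
  predecessor is the exponent sought.\<close>

lemma leading_exponent_ex:
  assumes "0 < x" shows "\<exists>a. omega_pow a \<le> x \<and> x < omega_pow (osuc a)"
proof -
  define c where "c = (LEAST c. x < omega_pow c)"
  have "x < omega_pow (osuc x)" using omega_pow_ge[of "osuc x"] by (simp add: osuc_le_iff)
  then have c: "x < omega_pow c" unfolding c_def by (rule LeastI)
  have least: "omega_pow d \<le> x" if "d < c" for d
    using that not_less_Least unfolding c_def by fastforce
  show ?thesis
  proof (cases c rule: omega1_cases)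
    case zero
    then show ?thesis using c assms less_osuc_iff[of x 0]
      by (auto simp: omega_pow_zero one_omega1_def)
  next
    case limit
    then show ?thesis using c least less_omega_pow_limit_iff leD by blast
  next
    case (succ b)
    then show ?thesis using c least[of b] by auto
  qed
qed

lemma cnf_ex: "\<exists>xs. sorted_wrt (\<ge>) xs \<and> cnf xs = x"
proof (induction x rule: less_induct)
  case (less x)
  show ?case
  proof (cases "x = 0")
    case True
    then show ?thesis by (intro exI[of _ "[]"]) simp
  next
    case False
    then obtain a where a: "omega_pow a \<le> x" "x < omega_pow (osuc a)"
      using leading_exponent_ex pos_iff_neq_zero by blast
    obtain y where y: "x = omega_pow a + y" using oplus_diff_ex[OF a(1)] by blast
    \<comment> \<open>The remainder has to be smaller for the induction. If
      \<open>x = omega_pow a + x\<close>, then \<open>x\<close> would dominate every finite multiple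
      of \<open>omega_pow a\<close> and hence reach the next power.\<close>
    have "y \<noteq> x"
    proof
      assume "y = x"
      have "ocopies n (omega_pow a) \<le> x" for n
      proof (induction n)
        case (Suc n)
        then have "omega_pow a + ocopies n (omega_pow a) \<le> omega_pow a + y"
          using \<open>y = x\<close> by (intro oplus_mono) simp
        then show ?case unfolding ocopies_Suc y[symmetric] .
      qed simp
      then show False using a(2) less_omega_pow_osuc_iff leD by blast
    qed
    then have "y < x" using y le_oplus_left[of y "omega_pow a"] by (simp add: less_le)
    then obtain ys where ys: "sorted_wrt (\<ge>) ys" "cnf ys = y" using less by blast
    have "c \<le> a" if c: "c \<in> set ys" for c
    proof -
      obtain d ds where d: "ys = d # ds" using c by (cases ys) auto
      have "omega_pow d \<le> y" using d ys by (auto simp: le_oplus_right)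
      also have "\<dots> < omega_pow (osuc a)" using \<open>y < x\<close> a by simp
      finally show ?thesis using d ys c by (auto simp: less_osuc_iff)
    qed
    then show ?thesis using ys y by (intro exI[of _ "a # ys"]) simp
  qed
qed

section \<open>Membership in the Schreier families via Cantor normal forms\<close>

lemma block_less_simps [simp]:
  "block_less {} t" "block_less s {}"
  "block_less (s \<union> s') t \<longleftrightarrow> block_less s t \<and> block_less s' t"
  "block_less s (t \<union> t') \<longleftrightarrow> block_less s t \<and> block_less s t'"
  "block_less (\<Union>i\<in>I. S i) t \<longleftrightarrow> (\<forall>i\<in>I. block_less (S i) t)"
  "block_less s (\<Union>i\<in>I. S i) \<longleftrightarrow> (\<forall>i\<in>I. block_less s (S i))"
  by (auto simp: block_less_def)

lemma block_seq_Suc: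
  "block_seq (Suc n) S \<longleftrightarrow> block_seq n S \<and> block_less (\<Union>i\<in>{1..n}. S i) (S (Suc n))"
  by (auto simp: block_seq_def le_Suc_eq)

lemma block_seq_cong:
  "(\<And>i. i \<in> {1..n} \<Longrightarrow> S i = T i) \<Longrightarrow> block_seq n S = block_seq n T"
  unfolding block_seq_def by (intro all_cong1 imp_cong) auto

text \<open>Nonemptiness at positive indices is what gives the first block, and hence the whole set,
  a minimum.\<close>

lemma schreier_mem_finite:
  "schreier_mem lam x s \<Longrightarrow> finite s \<and> s \<subseteq> posnats \<and> (x \<noteq> 0 \<longrightarrow> s \<noteq> {})"
proof (induction rule: schreier_mem.induct)
  case (pow_succ n S b)
  have "1 \<in> {1..n}" "S 1 \<noteq> {}" using pow_succ.hyps(1) pow_succ.IH by auto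
  then have "(\<Union>i\<in>{1..n}. S i) \<noteq> {}" by blast
  moreover have "finite (\<Union>i\<in>{1..n}. S i)" "(\<Union>i\<in>{1..n}. S i) \<subseteq> posnats"
    using pow_succ by blast+
  ultimately show ?case by simp
next
  case (pow_limit l s n)
  then show ?case by simp
next
  case (sum x a p m S)
  have IH: "finite (S i j)" "S i j \<subseteq> posnats" "S i j \<noteq> {}" if "i \<le> m" "j \<in> {1..p i}" for i j
    using sum.IH that by auto
  have "1 \<in> {1..p 0}" using sum.hyps by simp
  then have "S 0 1 \<noteq> {}" "S 0 1 \<subseteq> (\<Union>i\<in>{0..m}. \<Union>j\<in>{1..p i}. S i j)"
    using IH(3)[of 0 1] by fastforce+
  then have "(\<Union>i\<in>{0..m}. \<Union>j\<in>{1..p i}. S i j) \<noteq> {}" by blast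
  moreover have "finite (\<Union>i\<in>{0..m}. \<Union>j\<in>{1..p i}. S i j)"
    using IH(1) by simp
  moreover have "(\<Union>i\<in>{0..m}. \<Union>j\<in>{1..p i}. S i j) \<subseteq> posnats"
    using IH(2) by (intro UN_least) auto
  ultimately show ?case by blast
qed (auto simp: oplus_one)

section \<open>Inversion of the inductive rules\<close>

lemma schreier_mem_zero_iff [simp]: "schreier_mem lam 0 s \<longleftrightarrow> s = {}"
proof
  show "s = {}" if "schreier_mem lam 0 s"
    using that
  proof (cases rule: schreier_mem.cases)
    case (pow_succ n S b)
    then show ?thesis using omega_pow_pos[of "b + 1"] by simp
  next
    case (pow_limit l n)
    then show ?thesis using omega_pow_pos[of l] by simp
  qed (auto simp: oplus_one is_limit_def)
qed (auto intro: schreier_mem.zero)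

lemma is_limit_omega_pow_iff: "is_limit (omega_pow a) \<longleftrightarrow> 0 < a"
  using is_limit_omega_pow[of a] is_limit_not_succ[of "omega_pow 0" 0]
  by (auto simp: pos_iff_neq_zero omega_pow_zero)

text \<open>The rules \<open>pow_succ\<close>, \<open>pow_limit\<close> and \<open>sum\<close> all
  conclude at limit indices, so only \<open>succ\<close> can produce a successor index.\<close>

lemma schreier_mem_succ_iff:
  "schreier_mem lam (z + 1) s \<longleftrightarrow>
     (\<exists>n t. 1 \<le> n \<and> block_less {n} t \<and> s = insert n t \<and> schreier_mem lam z t)"
proof
  assume "schreier_mem lam (z + 1) s"
  then show "\<exists>n t. 1 \<le> n \<and> block_less {n} t \<and> s = insert n t \<and> schreier_mem lam z t"
  proof (cases rule: schreier_mem.cases)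
    case (pow_succ n S b)
    then show ?thesis
      using is_limit_omega_pow_iff[of "b + 1"] is_limit_not_succ[of "omega_pow (b + 1)" z]
      by (auto simp: oplus_one pos_iff_neq_zero)
  next
    case (pow_limit l n)
    then show ?thesis
      using is_limit_omega_pow_iff[of l] is_limit_not_succ[of "omega_pow l" z] is_limit_pos[of l]
      by auto
  qed (auto simp: oplus_one is_limit_def)
qed (use schreier_mem.succ in force)

lemma schreier_mem_omega_pow_zero_iff:
  "schreier_mem lam (omega_pow 0) s \<longleftrightarrow> (\<exists>n\<ge>1. s = {n})"
  using schreier_mem_succ_iff[of lam 0 s] by (auto simp: omega_pow_zero)

lemma schreier_mem_omega_pow_limit_iff:
  assumes "is_limit l"
  shows "schreier_mem lam (omega_pow l) s \<longleftrightarrow>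
    s \<noteq> {} \<and> schreier_mem lam (omega_pow (lam l (Min s))) s"
proof
  have l: "is_limit (omega_pow l)" using assms by (simp add: is_limit_omega_pow_iff is_limit_pos)
  assume "schreier_mem lam (omega_pow l) s"
  then show "s \<noteq> {} \<and> schreier_mem lam (omega_pow (lam l (Min s))) s"
  proof (cases rule: schreier_mem.cases)
    case zero
    then show ?thesis using omega_pow_pos[of l] by simp
  next
    case succ
    then show ?thesis using l is_limit_not_succ by blast
  next
    case (pow_succ n S b)
    then show ?thesis using assms is_limit_not_succ by simp
  next
    case (sum a p m S)
    then have "omega_pow (a 0) < omega_pow l" "omega_pow l < omega_pow (osuc (a 0))"
      by (simp_all only: oplus_one)
    then show ?thesis by (simp add: less_osuc_iff)
  qed auto
qed (use assms schreier_mem.pow_limit in blast)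

text \<open>Exponents are listed from the leading term on, so the head of the list belongs to the last
  block.\<close>

fun blocks :: "(omega1 \<Rightarrow> nat \<Rightarrow> omega1) \<Rightarrow> omega1 list \<Rightarrow> nat set \<Rightarrow> bool" where
  "blocks lam [] s \<longleftrightarrow> s = {}"
| "blocks lam (a # as) s \<longleftrightarrow>
     (\<exists>u v. s = u \<union> v \<and> block_less u v \<and> blocks lam as u \<and> schreier_mem lam (omega_pow a) v)"

text \<open>The order is reversed: the tail \<open>bs\<close> of the list governs the initial part
  \<open>u\<close> of the set. The proof only regroups three consecutive parts.\<close>

lemma blocks_append:
  "blocks lam (as @ bs) s \<longleftrightarrow>
     (\<exists>u v. s = u \<union> v \<and> block_less u v \<and> blocks lam bs u \<and> blocks lam as v)"
proof (induction as arbitrary: s)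
  case (Cons a as)
  show ?case
  proof
    assume "blocks lam ((a # as) @ bs) s"
    then obtain u v w where "s = (u \<union> v) \<union> w" "block_less (u \<union> v) w" "block_less u v"
      "blocks lam bs u" "blocks lam as v" "schreier_mem lam (omega_pow a) w"
      using Cons.IH by auto
    then show "\<exists>u v. s = u \<union> v \<and> block_less u v \<and> blocks lam bs u \<and> blocks lam (a # as) v"
      by (intro exI[of _ u] exI[of _ "v \<union> w"]) auto
  next
    assume "\<exists>u v. s = u \<union> v \<and> block_less u v \<and> blocks lam bs u \<and> blocks lam (a # as) v"
    then obtain u v w where "s = u \<union> (v \<union> w)" "block_less u (v \<union> w)" "block_less v w"
      "blocks lam bs u" "blocks lam as v" "schreier_mem lam (omega_pow a) w"
      by auto
    then have "s = (u \<union> v) \<union> w" "block_less (u \<union> v) w" "blocks lam (as @ bs) (u \<union> v)"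
      using Cons.IH[of "u \<union> v"] by auto
    then show "blocks lam ((a # as) @ bs) s"
      using \<open>schreier_mem lam (omega_pow a) w\<close> unfolding append_Cons blocks.simps by blast
  qed
qed auto

lemma blocks_single [simp]: "blocks lam [a] s \<longleftrightarrow> schreier_mem lam (omega_pow a) s"
  by auto

lemma blocks_snoc:
  "blocks lam (as @ [a]) s \<longleftrightarrow>
     (\<exists>u v. s = u \<union> v \<and> block_less u v \<and> schreier_mem lam (omega_pow a) u \<and> blocks lam as v)"
  by (simp add: blocks_append)

text \<open>Translates the recursive description into the indexed block sequences of rule
  \<open>pow_succ\<close>. Here \<open>S 1\<close> is the first block, so unfolding one copy splits
  off \<open>S (Suc n)\<close>.\<close>

lemma blocks_replicate:
  "blocks lam (replicate n a) s \<longleftrightarrow>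
     (\<exists>S. s = (\<Union>i\<in>{1..n}. S i) \<and> block_seq n S \<and>
       (\<forall>i\<in>{1..n}. schreier_mem lam (omega_pow a) (S i)))"
proof (induction n arbitrary: s)
  case (Suc n)
  have ins: "{1..Suc n} = insert (Suc n) {1..n}" by auto
  show ?case
  proof
    assume "blocks lam (replicate (Suc n) a) s"
    then obtain u v where uv: "s = u \<union> v" "block_less u v" "blocks lam (replicate n a) u"
      "schreier_mem lam (omega_pow a) v"
      by auto
    then obtain S where S: "u = (\<Union>i\<in>{1..n}. S i)" "block_seq n S"
      "\<forall>i\<in>{1..n}. schreier_mem lam (omega_pow a) (S i)"
      using Suc.IH by blast
    have "block_seq n (S(Suc n := v))" using S(2) by (subst block_seq_cong[of n _ S]) auto
    then show "\<exists>S. s = (\<Union>i\<in>{1..Suc n}. S i) \<and> block_seq (Suc n) S \<and>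
        (\<forall>i\<in>{1..Suc n}. schreier_mem lam (omega_pow a) (S i))"
      using uv S by (intro exI[of _ "S(Suc n := v)"]) (auto simp: ins block_seq_Suc)
  next
    assume "\<exists>S. s = (\<Union>i\<in>{1..Suc n}. S i) \<and> block_seq (Suc n) S \<and>
        (\<forall>i\<in>{1..Suc n}. schreier_mem lam (omega_pow a) (S i))"
    then obtain S where S: "s = (\<Union>i\<in>{1..n}. S i) \<union> S (Suc n)" "block_seq (Suc n) S"
        "\<forall>i\<in>{1..Suc n}. schreier_mem lam (omega_pow a) (S i)"
      unfolding ins by auto
    moreover have "blocks lam (replicate n a) (\<Union>i\<in>{1..n}. S i)"
      using S unfolding Suc.IH block_seq_Suc ins by blast
    ultimately show "blocks lam (replicate (Suc n) a) s"
      unfolding replicate_Suc blocks.simps block_seq_Suc by (metis atLeastAtMost_iff le_refl le_add1 plus_1_eq_Suc)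
  qed
qed (auto simp: block_seq_def)

text \<open>The same translation for the doubly indexed blocks of rule \<open>sum\<close>. A group
  with larger index precedes those with smaller index in the set, so the last group splits off as
  the initial part.\<close>

lemma blocks_concat:
  "blocks lam (concat (map (\<lambda>i. replicate (p i) (a i)) [0..<m])) s \<longleftrightarrow>
     (\<exists>S. s = (\<Union>i\<in>{0..<m}. \<Union>j\<in>{1..p i}. S i j) \<and> (\<forall>i<m. block_seq (p i) (S i)) \<and>
       (\<forall>i k. i < k \<and> k < m \<longrightarrow> block_less (\<Union>j\<in>{1..p k}. S k j) (\<Union>j\<in>{1..p i}. S i j)) \<and>
       (\<forall>i<m. \<forall>j\<in>{1..p i}. schreier_mem lam (omega_pow (a i)) (S i j)))"
    (is "?L m s \<longleftrightarrow> (\<exists>S. ?R m s S)")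
proof (induction m arbitrary: s)
  case (Suc m)
  have ins: "{0..<Suc m} = insert m {0..<m}" by auto
  show ?case
  proof
    assume "?L (Suc m) s"
    then obtain u v where uv: "s = u \<union> v" "block_less u v"
        "blocks lam (replicate (p m) (a m)) u" "?L m v"
      by (auto simp: blocks_append)
    obtain T where T: "u = (\<Union>i\<in>{1..p m}. T i)" "block_seq (p m) T"
       "\<forall>i\<in>{1..p m}. schreier_mem lam (omega_pow (a m)) (T i)"
      using uv(3) unfolding blocks_replicate by blast
    obtain S where S: "?R m v S" using uv(4) unfolding Suc.IH by blast
    have "?R (Suc m) s (S(m := T))"
    proof (intro conjI allI impI)
      show "s = (\<Union>i\<in>{0..<Suc m}. \<Union>j\<in>{1..p i}. (S(m := T)) i j)"
        using uv T S by (auto simp: ins)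
      fix i k assume "i < k \<and> k < Suc m"
      then show "block_less (\<Union>j\<in>{1..p k}. (S(m := T)) k j) (\<Union>j\<in>{1..p i}. (S(m := T)) i j)"
        using uv(2) S unfolding T by (auto simp: less_Suc_eq)
    qed (use T S in \<open>auto simp: less_Suc_eq\<close>)
    then show "\<exists>S. ?R (Suc m) s S" by blast
  next
    assume "\<exists>S. ?R (Suc m) s S"
    then obtain S where S: "?R (Suc m) s S" by blast
    note s = S[THEN conjunct1]
      and seq = S[THEN conjunct2, THEN conjunct1, rule_format]
      and less = S[THEN conjunct2, THEN conjunct2, THEN conjunct1, rule_format, OF conjI]
      and mem = S[THEN conjunct2, THEN conjunct2, THEN conjunct2, rule_format]
    let ?u = "\<Union>j\<in>{1..p m}. S m j" and ?v = "\<Union>i\<in>{0..<m}. \<Union>j\<in>{1..p i}. S i j"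
    have "?R m ?v S"
    proof (intro conjI allI impI ballI refl)
      fix i assume "i < m"
      then show "block_seq (p i) (S i)" by (intro seq) simp
    next
      fix i k assume "i < k \<and> k < m"
      then show "block_less (\<Union>j\<in>{1..p k}. S k j) (\<Union>j\<in>{1..p i}. S i j)"
        by (intro less) simp_all
    next
      fix i j assume "i < m" "j \<in> {1..p i}"
      then show "schreier_mem lam (omega_pow (a i)) (S i j)" by (intro mem) simp_all
    qed
    then have "?L m ?v" unfolding Suc.IH by (rule exI[of "?R m ?v" S])
    moreover have "blocks lam (replicate (p m) (a m)) ?u"
      unfolding blocks_replicate using seq[of m] mem[of m] by blast
    moreover have "s = ?u \<union> ?v" using s by (simp add: ins)
    moreover have "block_less ?u (\<Union>j\<in>{1..p i}. S i j)" if "i \<in> {0..<m}" for i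
      by (rule less) (use that in simp_all)
    then have "block_less ?u ?v" unfolding block_less_def by blast
    ultimately have "blocks lam (concat (map (\<lambda>i. replicate (p i) (a i)) [0..<m]) @
        replicate (p m) (a m)) s"
      unfolding blocks_append by blast
    then show "?L (Suc m) s" by simp
  qed
qed simp

text \<open>Supplies the strictly decreasing exponents and positive coefficients that rule
  \<open>sum\<close> asks for. A new last entry either raises the last multiplicity or opens a new
  group.\<close>

lemma run_length_encoding:
  fixes xs :: "'a::linorder list"
  assumes "sorted_wrt (\<ge>) xs" "xs \<noteq> []"
  shows "\<exists>m p a. xs = concat (map (\<lambda>i. replicate (p i) (a i)) [0..<Suc m]) \<and>
    (\<forall>i<m. a (Suc i) < a i) \<and> (\<forall>i\<le>m. 1 \<le> p i)"
  using assms
proof (induction xs rule: rev_induct)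
  case (snoc x xs)
  show ?case
  proof (cases "xs = []")
    case True
    then show ?thesis by (intro exI[of _ 0] exI[of _ "\<lambda>_. 1"] exI[of _ "\<lambda>_. x"]) simp
  next
    case False
    then obtain m p a where mpa: "xs = concat (map (\<lambda>i. replicate (p i) (a i)) [0..<Suc m])"
      "\<forall>i<m. a (Suc i) < a i" "\<forall>i\<le>m. 1 \<le> p i"
      using snoc by (auto simp: sorted_wrt_append)
    have "a m \<in> set xs" using mpa(1) mpa(3)[rule_format, of m] by simp
    then have "x \<le> a m" using snoc.prems by (simp add: sorted_wrt_append)
    then consider "x = a m" | "x < a m" by fastforce
    then show ?thesis
    proof cases
      case 1
      have eq: "concat (map (\<lambda>i. replicate ((p(m := Suc (p m))) i) (a i)) [0..<m]) =
          concat (map (\<lambda>i. replicate (p i) (a i)) [0..<m])"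
        by (intro arg_cong[of _ _ concat] map_cong) auto
      show ?thesis using mpa 1 replicate_append_same[of "p m" "a m"] eq
        by (intro exI[of _ m] exI[of _ "p(m := Suc (p m))"] exI[of _ a]) simp
    next
      case 2
      have eq: "concat (map (\<lambda>i. replicate ((p(Suc m := 1)) i) ((a(Suc m := x)) i)) [0..<Suc m]) =
          concat (map (\<lambda>i. replicate (p i) (a i)) [0..<Suc m])"
        by (intro arg_cong[of _ _ concat] map_cong) auto
      have "xs @ [x] = concat (map (\<lambda>i. replicate ((p(Suc m := 1)) i) ((a(Suc m := x)) i))
          [0..<Suc (Suc m)])"
        unfolding upt_Suc_append[OF le0, of "Suc m"] map_append concat_append eq mpa(1)[symmetric] by simp
      then show ?thesis using mpa(2,3) 2
        by (intro exI[of _ "Suc m"] exI[of _ "p(Suc m := 1)"] exI[of _ "a(Suc m := x)"])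
          (auto simp: less_Suc_eq le_Suc_eq)
    qed
  qed
qed simp

lemma strict_dec_less:
  fixes a :: "nat \<Rightarrow> 'a::order"
  assumes "\<forall>i<m. a (i + 1) < a i" "i < j" "j \<le> m" shows "a j < a i"
  using assms(2,3)
proof (induction j)
  case (Suc j)
  then have "a (Suc j) < a j" using assms(1) by simp
  then show ?case using Suc by (cases "i = j") (auto intro: order.strict_trans)
qed simp

lemma sorted_wrt_replicate: "R a a \<Longrightarrow> sorted_wrt R (replicate n a)"
  by (induction n) simp_all

lemma sorted_wrt_concat_replicate:
  fixes a :: "nat \<Rightarrow> 'a::order"
  assumes "\<And>i j. i < j \<Longrightarrow> j < m \<Longrightarrow> a j \<le> a i"
  shows "sorted_wrt (\<ge>) (concat (map (\<lambda>i. replicate (p i) (a i)) [0..<m]))"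
  using assms
proof (induction m)
  case (Suc m)
  then show ?case
    by (auto simp: sorted_wrt_append sorted_wrt_replicate)
qed simp

lemma cnf_concat_replicate:
  "cnf (concat (map (\<lambda>i. replicate (p i) (a i)) xs)) =
    sum_list (map (\<lambda>i. ocopies (p i) (omega_pow (a i))) xs)"
  by (induction xs) (simp_all add: cnf_replicate)

text \<open>A last exponent 0 makes the index a successor. The first block is then a singleton,
  namely the point that rule \<open>succ\<close> puts in front.\<close>

lemma schreier_mem_cnf_snoc_zero:
  assumes "blocks lam (as @ [0]) s" "\<And>t. blocks lam as t \<Longrightarrow> schreier_mem lam (cnf as) t"
  shows "schreier_mem lam (cnf (as @ [0])) s"
proof -
  obtain n v where "1 \<le> n" "s = {n} \<union> v" "block_less {n} v" "blocks lam as v"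
    using assms(1) by (auto simp: blocks_snoc schreier_mem_omega_pow_zero_iff)
  then show ?thesis using assms(2) schreier_mem.succ[of n v lam "cnf as"]
    by (simp add: omega_pow_zero)
qed

text \<open>Positive exponents make the index a limit, and two or more terms place it strictly
  between the leading power and the next one. This is exactly the range of rule
  \<open>sum\<close>.\<close>

lemma schreier_mem_cnf_limit:
  assumes "sorted_wrt (\<ge>) xs" "0 \<notin> set xs" "2 \<le> length xs" "blocks lam xs s"
  shows "schreier_mem lam (cnf xs) s"
proof -
  have "xs \<noteq> []" using assms(3) by auto
  then obtain m p a where mpa: "xs = concat (map (\<lambda>i. replicate (p i) (a i)) [0..<Suc m])"
      "\<forall>i<m. a (Suc i) < a i" "\<forall>i\<le>m. 1 \<le> p i"
    using run_length_encoding[OF assms(1)] by blast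
  have pos: "0 < a i" if "i \<le> m" for i
  proof -
    have "a i \<in> set xs" using that mpa(1) mpa(3)[rule_format, of i] 
      by (cases "i = m") (auto simp: less_Suc_eq_le)
    then show ?thesis using assms(2) by (metis pos_iff_neq_zero)
  qed
  obtain c ys where xs: "xs = c # ys" "ys \<noteq> []" using assms(3)
    by (cases xs; cases "tl xs") auto
  have "xs ! 0 = a 0"
    using mpa(3)[rule_format, of 0] unfolding mpa(1) upt_conv_Cons[OF zero_less_Suc]
    by (simp add: nth_append)
  then have c: "c = a 0" using xs by simp
  obtain S where S: "s = (\<Union>i\<in>{0..<Suc m}. \<Union>j\<in>{1..p i}. S i j)"
    "\<forall>i<Suc m. block_seq (p i) (S i)"
    "\<forall>i k. i < k \<and> k < Suc m \<longrightarrow> block_less (\<Union>j\<in>{1..p k}. S k j) (\<Union>j\<in>{1..p i}. S i j)"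
    "\<forall>i<Suc m. \<forall>j\<in>{1..p i}. schreier_mem lam (omega_pow (a i)) (S i j)"
    using assms(4) unfolding mpa(1) blocks_concat by blast
  have "last xs \<noteq> 0" using assms(2) \<open>xs \<noteq> []\<close> last_in_set by metis
  then have "is_limit (cnf (butlast xs) + omega_pow (last xs))"
    by (intro is_limit_oplus is_limit_omega_pow) (simp add: pos_iff_neq_zero)
  then have lim: "is_limit (cnf xs)"
    by (metis \<open>xs \<noteq> []\<close> append_butlast_last_id add.right_neutral cnf_simps)
  have "0 < cnf ys" using xs(2) by (cases ys) (auto simp: less_le_trans[OF omega_pow_pos le_oplus_right])
  then have "omega_pow (a 0) < cnf xs" using xs c oplus_strict_mono[of 0] by simp
  moreover have "cnf xs < omega_pow (a 0 + 1)" unfolding oplus_one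
    using assms(1) xs c by (intro cnf_less_omega_pow_osuc) auto
  moreover have "{0..m} = {0..<Suc m}" by auto
  ultimately show ?thesis
    unfolding S(1) using S(2-4) lim mpa(2,3) pos
      
      schreier_mem.sum[where x = "cnf xs" and a = a and m = m and p = p and S = S and lam = lam] cnf_concat_replicate[of p a "[0..<Suc m]"]
    unfolding mpa(1)[symmetric] by (simp add: less_Suc_eq_le)
qed

text \<open>From membership to blocks, uniqueness of normal forms identifies the list belonging to
  the rule with the given one. Conversely, the last exponent and the length decide which rule
  applies. The induction runs from the right because rule \<open>succ\<close> removes a last
  exponent 0.\<close>

lemma schreier_mem_cnf_iff:
  "sorted_wrt (\<ge>) xs \<Longrightarrow> schreier_mem lam (cnf xs) s \<longleftrightarrow> blocks lam xs s"
proof (induction xs arbitrary: s rule: rev_induct)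
  case Nil
  then show ?case by simp
next
  case (snoc b as)
  have sorted: "sorted_wrt (\<ge>) as" using snoc.prems by (simp add: sorted_wrt_append)
  show ?case
  proof
    assume bl: "blocks lam (as @ [b]) s"
    show "schreier_mem lam (cnf (as @ [b])) s"
    proof (cases "b = 0")
      case True
      then show ?thesis using bl snoc.IH[OF sorted] schreier_mem_cnf_snoc_zero by blast
    next
      case False
      then have "0 \<notin> set (as @ [b])"
        using snoc.prems by (auto simp: sorted_wrt_append)
          (metis omega1_zero_le order.antisym)
      then show ?thesis
        using bl snoc.prems schreier_mem_cnf_limit[of "as @ [b]" lam s]
        by (cases "as = []") (auto simp: Suc_le_eq)
    qed
  next
    assume mem: "schreier_mem lam (cnf (as @ [b])) s"
    then show "blocks lam (as @ [b]) s"
    proof (cases rule: schreier_mem.cases)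
      case zero
      then show ?thesis using cnf_eq_zero_iff[of "as @ [b]"] by (simp del: cnf_eq_zero_iff)
    next
      case (succ n t z)
      have "b = 0"
      proof (rule ccontr)
        assume "b \<noteq> 0"
        then have "is_limit (cnf (as @ [b]))"
          by (simp add: is_limit_oplus is_limit_omega_pow pos_iff_neq_zero)
        then show False using succ(1) is_limit_not_succ by blast
      qed
      then have "cnf as = z" using succ(1) by (simp add: omega_pow_zero oplus_one)
      then show ?thesis
        using succ snoc.IH[OF sorted, of t] \<open>b = 0\<close>
        by (auto simp: blocks_snoc schreier_mem_omega_pow_zero_iff)
    next
      case (pow_succ n S c)
      then have "as @ [b] = [c + 1]" using snoc.prems by (intro cnf_inject) auto
      then show ?thesis using mem by simp
    next
      case (pow_limit l n)
      then have "as @ [b] = [l]" using snoc.prems by (intro cnf_inject) auto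
      then show ?thesis using mem by simp
    next
      case (sum a p m S)
      let ?ys = "concat (map (\<lambda>i. replicate (p i) (a i)) [0..<m + 1])"
      have dec: "\<forall>i<m. a (i + 1) < a i" by fact
      have "sorted_wrt (\<ge>) ?ys"
        using strict_dec_less[OF dec] by (intro sorted_wrt_concat_replicate less_imp_le) simp
      moreover have "cnf (as @ [b]) = cnf ?ys"
        unfolding cnf_concat_replicate by fact
      ultimately have "as @ [b] = ?ys" using snoc.prems cnf_inject by blast
      moreover have "blocks lam ?ys s"
        unfolding blocks_concat using sum
        by (intro exI[of _ S]) (simp add: less_Suc_eq_le atLeastLessThanSuc_atLeastAtMost)
      ultimately show ?thesis by simp
    qed
  qed
qed

lemma Min_insert_less: "finite s \<Longrightarrow> \<forall>k\<in>s. n < k \<Longrightarrow> Min (insert n s) = (n::nat)"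
  by (auto intro!: Min_eqI dest: less_imp_le)

text \<open>Rule \<open>pow_succ\<close> counts blocks by the minimum of the first one. Since the
  blocks increase, this is the minimum of the whole set, so the count can be read off from
  \<open>s\<close> alone.\<close>

lemma schreier_mem_omega_pow_succ_iff:
  "schreier_mem lam (omega_pow (osuc b)) s \<longleftrightarrow> s \<noteq> {} \<and> finite s \<and> blocks lam (replicate (Min s) b) s"
proof
  assume mem: "schreier_mem lam (omega_pow (osuc b)) s"
  have ne: "s \<noteq> {}" "finite s" using schreier_mem_finite[OF mem] by simp_all
  show "s \<noteq> {} \<and> finite s \<and> blocks lam (replicate (Min s) b) s"
    using mem
  proof (cases rule: schreier_mem.cases)
    case zero
    then show ?thesis using omega_pow_neq_zero[of "osuc b"] by simp
  next
    case succ
    moreover have "is_limit (omega_pow (osuc b))"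
      by (simp add: is_limit_omega_pow_iff pos_iff_neq_zero)
    ultimately show ?thesis using is_limit_not_succ by blast
  next
    case (pow_succ n S c)
    then have "c = b" by (simp add: oplus_one)
    have one: "1 \<in> {1..n}" using pow_succ by simp
    then have S1: "finite (S 1)" "S 1 \<noteq> {}"
      using pow_succ schreier_mem_finite[of lam "omega_pow c" "S 1"] by simp_all
    have "S 1 \<subseteq> s" unfolding pow_succ(2) using one by blast
    note S1 = S1 this
    have "Min s = Min (S 1)"
    proof (rule Min_eqI[OF ne(2)])
      show "Min (S 1) \<in> s" using S1 Min_in by blast
      fix y assume "y \<in> s"
      then obtain i where i: "i \<in> {1..n}" "y \<in> S i" using pow_succ(2) by blast
      show "Min (S 1) \<le> y"
      proof (cases "i = 1")
        case False
        then have "block_less (S 1) (S i)" using pow_succ(5) i by (simp add: block_seq_def)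
        then show ?thesis using Min_in[OF S1(1,2)] i by (auto simp: block_less_def intro: less_imp_le)
      qed (use S1 i in simp)
    qed
    then have "Min s = n" using pow_succ by simp
    moreover have "blocks lam (replicate n b) s"
      unfolding blocks_replicate using pow_succ \<open>c = b\<close> by blast
    ultimately show ?thesis using ne by simp
  next
    case (pow_limit l n)
    then have "is_limit (osuc b)" by simp
    then show ?thesis by (simp add: is_limit_def)
  next
    case (sum a p m S)
    then have "omega_pow (a 0) < omega_pow (osuc b)" "omega_pow (osuc b) < omega_pow (osuc (a 0))"
      by (simp_all only: oplus_one)
    then show ?thesis by (simp add: less_osuc_iff osuc_le_iff)
  qed
next
  assume s: "s \<noteq> {} \<and> finite s \<and> blocks lam (replicate (Min s) b) s"
  then obtain S where S: "s = (\<Union>i\<in>{1..Min s}. S i)" "block_seq (Min s) S"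
      "\<forall>i\<in>{1..Min s}. schreier_mem lam (omega_pow b) (S i)"
    unfolding blocks_replicate by blast
  \<comment> \<open>Minimum 0 would mean no blocks at all, contradicting that \<open>s\<close> is
    nonempty.\<close>
  have n: "1 \<le> Min s" using s S(1) by (cases "Min s") auto
  then have one: "1 \<in> {1..Min s}" by simp
  then have S1: "finite (S 1)" "S 1 \<noteq> {}"
    using S(3) schreier_mem_finite[of lam "omega_pow b" "S 1"] by simp_all
  have "S 1 \<subseteq> s" using one S(1) by blast
  note S1 = S1 this
  have "Min (S 1) \<le> Min s"
  proof -
    have "Min s \<in> s" using s by simp
    then obtain i where i: "i \<in> {1..Min s}" "Min s \<in> S i" using S(1) by blast
    show ?thesis
    proof (cases "i = 1")
      case False
      then have "block_less (S 1) (S i)" using S(2) i by (simp add: block_seq_def)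
      then show ?thesis using Min_in[OF S1(1,2)] i by (auto simp: block_less_def intro: less_imp_le)
    qed (use S1 i in simp)
  qed
  then have "Min s = Min (S 1)" using S1 s Min_antimono[of "S 1" s] order.antisym by blast
  then have "schreier_mem lam (omega_pow (b + 1)) (\<Union>i\<in>{1..Min s}. S i)"
    using n S by (intro schreier_mem.pow_succ)
  then show "schreier_mem lam (omega_pow (osuc b)) s" using S(1) by (simp add: oplus_one)
qed

section \<open>Sections of the Schreier families\<close>

lemma blocks_finite: "blocks lam xs s \<Longrightarrow> finite s"
  by (induction xs arbitrary: s) (auto dest: schreier_mem_finite)

text \<open>The point \<open>n\<close> lies below \<open>s\<close>, so it falls into the first
  block, the one governed by the last exponent. Removing \<open>n\<close> therefore replaces
  \<open>a\<close> by the exponents \<open>r\<close> of its section and leaves \<open>as\<close>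
  alone.\<close>

lemma blocks_snoc_insert:
  assumes s: "\<forall>k\<in>s. n < k"
    and r: "\<And>u. \<forall>k\<in>u. n < k \<Longrightarrow> schreier_mem lam (omega_pow a) (insert n u) \<longleftrightarrow> blocks lam r u"
  shows "blocks lam (as @ [a]) (insert n s) \<longleftrightarrow> blocks lam (as @ r) s"
proof
  assume "blocks lam (as @ [a]) (insert n s)"
  then obtain u v where uv: "insert n s = u \<union> v" "block_less u v"
      "schreier_mem lam (omega_pow a) u" "blocks lam as v"
    by (auto simp: blocks_snoc)
  have "u \<noteq> {}" using schreier_mem_finite[OF uv(3)] by simp
  then have n: "n \<in> u" "n \<notin> v"
    using uv(1,2) s unfolding block_less_def by (metis Un_iff all_not_in_conv insert_iff less_asym order_less_irrefl)+
  then have "insert n (u - {n}) = u" "s = (u - {n}) \<union> v" "\<forall>k\<in>u - {n}. n < k"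
    using uv(1) s by auto
  moreover have "block_less (u - {n}) v" using uv(2) by (simp add: block_less_def)
  ultimately show "blocks lam (as @ r) s"
    unfolding blocks_append using uv r[of "u - {n}"] by metis
next
  assume "blocks lam (as @ r) s"
  then obtain u v where uv: "s = u \<union> v" "block_less u v" "blocks lam r u" "blocks lam as v"
    by (auto simp: blocks_append)
  then have "schreier_mem lam (omega_pow a) (insert n u)" "block_less (insert n u) v"
    using r[of u] s by (auto simp: block_less_def)
  then show "blocks lam (as @ [a]) (insert n s)"
    unfolding blocks_snoc using uv by (intro exI[of _ "insert n u"] exI[of _ v]) auto
qed

text \<open>A set with minimum \<open>n\<close> at a successor exponent \<open>osuc b\<close> has
  \<open>n\<close> blocks: the first loses its minimum and the other \<open>n - 1\<close> stay,
  whence \<open>replicate (n - 1) b @ r\<close>. At a limit the section is that of the exponent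
  \<open>lam a n\<close>. The last clause records a lower bound from which the growth of sections
  follows; it covers limits because ladder values are successors.\<close>

lemma omega_pow_section:
  assumes lam: "ladder_system lam" and n: "1 \<le> n"
  shows "\<exists>r. sorted_wrt (\<ge>) r \<and> (\<forall>c\<in>set r. c < a) \<and>
    (\<forall>s. (\<forall>k\<in>s. n < k) \<longrightarrow>
      (schreier_mem lam (omega_pow a) (insert n s) \<longleftrightarrow> blocks lam r s)) \<and>
    (\<forall>b. a = osuc b \<or> is_limit a \<and> lam a n = osuc b \<longrightarrow>
      ocopies (n - 1) (omega_pow b) \<le> cnf r)"
proof (induction a rule: less_induct)
  case (less a)
  show ?case
  proof (cases a rule: omega1_cases)
    case zero
    have "insert n s = {k} \<longleftrightarrow> k = n \<and> s = {}" if "\<forall>k\<in>s. n < k" for k s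
      using that by auto
    then show ?thesis using zero n
      by (intro exI[of _ "[]"]) (auto simp: schreier_mem_omega_pow_zero_iff is_limit_def)
  next
    case (succ b)
    obtain r where r: "sorted_wrt (\<ge>) r" "\<forall>c\<in>set r. c < b"
      "\<And>s. \<forall>k\<in>s. n < k \<Longrightarrow> schreier_mem lam (omega_pow b) (insert n s) \<longleftrightarrow> blocks lam r s"
      using less[of b] succ by auto
    \<comment> \<open>Splitting off the last copy of \<open>b\<close> exposes the first block, the
      one that contains \<open>n\<close>.\<close>
    have rep: "replicate n b = replicate (n - 1) b @ [b]"
      using n by (metis Suc_diff_1 less_eq_Suc_le One_nat_def replicate_Suc replicate_append_same)
    have iff: "schreier_mem lam (omega_pow a) (insert n s) \<longleftrightarrow> blocks lam (replicate (n - 1) b @ r) s"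
      if s: "\<forall>k\<in>s. n < k" for s
    proof (cases "finite s")
      case True
      then show ?thesis
        unfolding succ schreier_mem_omega_pow_succ_iff Min_insert_less[OF True s] rep
        using blocks_snoc_insert[OF s r(3)] by simp
    next
      \<comment> \<open>Members of either family are finite, so both sides fail for infinite
        \<open>s\<close>.\<close>
      case False
      then show ?thesis
        using blocks_finite schreier_mem_finite[of lam "omega_pow a" "insert n s"] by auto
    qed
    show ?thesis
    proof (intro exI[of _ "replicate (n - 1) b @ r"] conjI allI impI)
      show "sorted_wrt (\<ge>) (replicate (n - 1) b @ r)"
        using r by (auto simp: sorted_wrt_append intro!: sorted_wrt_replicate less_imp_le)
      show "\<forall>c\<in>set (replicate (n - 1) b @ r). c < a"
        using r(2) succ less_osuc[of b] by (auto intro: order.strict_trans)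
      fix d assume "a = osuc d \<or> is_limit a \<and> lam a n = osuc d"
      then have "d = b" using succ by (auto simp: is_limit_def)
      then show "ocopies (n - 1) (omega_pow d) \<le> cnf (replicate (n - 1) b @ r)"
        by (simp add: cnf_replicate le_oplus_right)
    qed (use iff in blast)
  next
    case limit
    then have lam_a: "is_succ (lam a n)" "lam a n < a" using lam n by (auto simp: ladder_system_def)
    obtain r where r: "sorted_wrt (\<ge>) r" "\<forall>c\<in>set r. c < lam a n"
      "\<And>s. \<forall>k\<in>s. n < k \<Longrightarrow>
        schreier_mem lam (omega_pow (lam a n)) (insert n s) \<longleftrightarrow> blocks lam r s"
      "\<And>b. lam a n = osuc b \<Longrightarrow> ocopies (n - 1) (omega_pow b) \<le> cnf r"
      using less[OF lam_a(2)] by blast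
    have iff: "schreier_mem lam (omega_pow a) (insert n s) \<longleftrightarrow> blocks lam r s"
      if s: "\<forall>k\<in>s. n < k" for s
    proof (cases "finite s")
      case True
      then show ?thesis
        unfolding schreier_mem_omega_pow_limit_iff[OF limit] Min_insert_less[OF True s]
        using r(3)[OF s] by simp
    next
      case False
      then show ?thesis
        using blocks_finite schreier_mem_finite[of lam "omega_pow a" "insert n s"] by auto
    qed
    show ?thesis
    proof (intro exI[of _ r] conjI allI impI)
      show "\<forall>c\<in>set r. c < a" using r(2) lam_a(2) by (auto intro: order.strict_trans)
      fix b assume "a = osuc b \<or> is_limit a \<and> lam a n = osuc b"
      then show "ocopies (n - 1) (omega_pow b) \<le> cnf r" using limit r(4) by (auto simp: is_limit_def)
    qed (use iff r(1) in auto)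
  qed
qed

text \<open>\<open>sec x n\<close> is the index of the family of all \<open>s\<close> beyond \<open>n\<close> such that \<open>insert n s\<close> belongs to
  the family with index \<open>x\<close>.\<close>

locale schreier_sections =
  fixes lam sec :: "omega1 \<Rightarrow> nat \<Rightarrow> omega1"
  assumes sec_less: "0 < x \<Longrightarrow> 1 \<le> n \<Longrightarrow> sec x n < x"
    and schreier_mem_insert:
      "0 < x \<Longrightarrow> 1 \<le> n \<Longrightarrow> \<forall>k\<in>s. n < k \<Longrightarrow>
        schreier_mem lam x (insert n s) \<longleftrightarrow> schreier_mem lam (sec x n) s"
    and sec_eventually_ge: "is_limit x \<Longrightarrow> y < x \<Longrightarrow> \<exists>N. \<forall>n\<ge>N. y \<le> sec x n"

section \<open>Growth of sections at limit indices\<close>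

lemma ladder_eventually_greater:
  assumes "ladder_system lam" "is_limit a" "d < a"
  shows "\<exists>N\<ge>1. \<forall>n\<ge>N. d < lam a n"
proof -
  have mono: "strict_mono_on {1..} (lam a)" and "(SUP n\<in>{1..}. lam a n) = a"
    using assms(1,2) by (auto simp: ladder_system_def)
  then have "d < (SUP n\<in>{1..}. lam a n)" using assms(3) by simp
  then obtain N where N: "N \<ge> 1" "d < lam a N"
    using less_cSUP_iff[OF _ omega1_bdd_above, of "{1..}" "lam a" d] by auto
  have "lam a N \<le> lam a n" if "N \<le> n" for n
    using N(1) that strict_mono_onD[OF mono, of N n] by (cases "N = n") (auto intro: less_imp_le)
  then show ?thesis using N by (meson less_le_trans)
qed

text \<open>At a successor exponent the multiples \<open>n - 1\<close> of the preceding power are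
  cofinal. At a limit exponent, once the ladder has passed \<open>d\<close>, a single copy of the
  power below \<open>lam a n\<close> already exceeds \<open>y\<close>.\<close>

lemma section_of_limit_eventually_greater:
  assumes "ladder_system lam" "0 < a" "y < omega_pow a"
    and r: "\<And>n b. 1 \<le> n \<Longrightarrow> a = osuc b \<or> is_limit a \<and> lam a n = osuc b \<Longrightarrow>
      ocopies (n - 1) (omega_pow b) \<le> cnf (r n)"
  shows "\<exists>N. \<forall>n\<ge>N. y \<le> cnf (r n)"
proof (cases a rule: omega1_cases)
  case zero
  then show ?thesis using assms(2) by simp
next
  case (succ b)
  then obtain k where k: "y < ocopies k (omega_pow b)"
    using assms(3) less_omega_pow_osuc_iff by auto
  have "y \<le> cnf (r n)" if "n \<ge> Suc k" for n
  proof -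
    have "ocopies k (omega_pow b) \<le> ocopies (n - 1) (omega_pow b)"
      using that by (intro ocopies_mono) simp
    then show ?thesis using k r[of n b] succ that by simp
  qed
  then show ?thesis by blast
next
  case limit
  then obtain d where d: "d < a" "y < omega_pow d"
    using assms(3) less_omega_pow_limit_iff by auto
  then obtain N where N: "N \<ge> 1" "\<And>n. n \<ge> N \<Longrightarrow> d < lam a n"
    using ladder_eventually_greater[OF assms(1) limit] by blast
  \<comment> \<open>The bound \<open>Suc N\<close> rather than \<open>N\<close> gives
    \<open>n \<ge> 2\<close>, so that \<open>n - 1\<close> leaves at least one copy.\<close>
  have "y \<le> cnf (r n)" if "n \<ge> Suc N" for n
  proof -
    have n: "1 \<le> n" "d < lam a n" "1 \<le> n - 1" using that N by auto
    then obtain b where b: "lam a n = osuc b"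
      using limit assms(1) by (auto simp: ladder_system_def is_succ_def)
    then have "omega_pow d \<le> omega_pow b" using n(2) by (simp add: less_osuc_iff)
    also have "\<dots> \<le> ocopies (n - 1) (omega_pow b)"
      using ocopies_mono[OF n(3), of "omega_pow b"] by (simp add: ocopies_Suc)
    also have "\<dots> \<le> cnf (r n)" using r n b limit by blast
    finally show ?thesis using d by simp
  qed
  then show ?thesis by blast
qed

lemma schreier_sections_ex:
  assumes lam: "ladder_system lam"
  shows "\<exists>sec. schreier_sections lam sec"
proof -
  define P where "P a n r \<longleftrightarrow> sorted_wrt (\<ge>) r \<and> (\<forall>c\<in>set r. c < a) \<and>
    (\<forall>s. (\<forall>k\<in>s. n < k) \<longrightarrow>
      (schreier_mem lam (omega_pow a) (insert n s) \<longleftrightarrow> blocks lam r s)) \<and>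
    (\<forall>b. a = osuc b \<or> is_limit a \<and> lam a n = osuc b \<longrightarrow>
      ocopies (n - 1) (omega_pow b) \<le> cnf r)" for a n r
  have "\<exists>r. P a n r" if "1 \<le> n" for a n
    unfolding P_def by (rule omega_pow_section[OF lam that])
  moreover define r where "r a n = (SOME r. P a n r)" for a n
  ultimately have "P a n (r a n)" if "1 \<le> n" for a n using that by (simp add: someI_ex)
  note P = this[unfolded P_def]
  have r: "\<And>a n. 1 \<le> n \<Longrightarrow> sorted_wrt (\<ge>) (r a n)" "\<And>a n. 1 \<le> n \<Longrightarrow> \<forall>c\<in>set (r a n). c < a"
    and r_mem: "\<And>a n s. 1 \<le> n \<Longrightarrow> \<forall>k\<in>s. n < k \<Longrightarrow>
      schreier_mem lam (omega_pow a) (insert n s) \<longleftrightarrow> blocks lam (r a n) s"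
    and r_ge: "\<And>a n b. 1 \<le> n \<Longrightarrow> a = osuc b \<or> is_limit a \<and> lam a n = osuc b \<Longrightarrow>
      ocopies (n - 1) (omega_pow b) \<le> cnf (r a n)"
    using P by blast+
  obtain xs where xs: "\<And>x. sorted_wrt (\<ge>) (xs x)" "\<And>x. cnf (xs x) = x"
    using cnf_ex by metis
  \<comment> \<open>Only the last exponent changes, since it governs the first block, where the
    minimum \<open>n\<close> lies.\<close>
  define sec where "sec x n = cnf (butlast (xs x) @ r (last (xs x)) n)" for x n
  have snoc: "xs x = butlast (xs x) @ [last (xs x)]" if "0 < x" for x
    using that xs(2)[of x] by (metis append_butlast_last_id cnf_simps(1) omega1_not_less_zero)
  have cnf: "x = cnf (butlast (xs x)) + omega_pow (last (xs x))" if "0 < x" for x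
    using arg_cong[OF snoc[OF that], of cnf] xs(2)[of x] by simp
  have "schreier_sections lam sec"
  proof
    fix x :: omega1 and n :: nat assume x: "0 < x" and n: "1 \<le> n"
    let ?as = "butlast (xs x)" and ?a = "last (xs x)"
    have "cnf (r ?a n) < omega_pow ?a" using r n by (intro cnf_less_omega_pow) auto
    then have "sec x n < cnf ?as + omega_pow ?a"
      unfolding sec_def cnf_simps by (rule oplus_strict_mono)
    then show "sec x n < x" using cnf[OF x] by simp
    fix s assume s: "\<forall>k\<in>s. n < k"
    have "sorted_wrt (\<ge>) (?as @ [?a])" using xs(1)[of x] snoc[OF x] by simp
    then have "sorted_wrt (\<ge>) (?as @ r ?a n)"
      using r[OF n, of ?a] by (fastforce simp: sorted_wrt_append)
    then have "schreier_mem lam (sec x n) s \<longleftrightarrow> blocks lam (?as @ r ?a n) s"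
      unfolding sec_def by (rule schreier_mem_cnf_iff)
    also have "\<dots> \<longleftrightarrow> blocks lam (?as @ [?a]) (insert n s)"
      by (rule blocks_snoc_insert[OF s r_mem[OF n], symmetric])
    also have "\<dots> \<longleftrightarrow> schreier_mem lam x (insert n s)"
      using schreier_mem_cnf_iff[OF xs(1)[of x], of lam "insert n s"] snoc[OF x] xs(2)[of x] by simp
    finally show "schreier_mem lam x (insert n s) \<longleftrightarrow> schreier_mem lam (sec x n) s" ..
  next
    fix x y :: omega1 assume x: "is_limit x" and y: "y < x"
    let ?as = "butlast (xs x)" and ?a = "last (xs x)"
    have x0: "0 < x" using x by (rule is_limit_pos)
    have "?a \<noteq> 0"
    proof
      assume "?a = 0"
      then have "x = cnf ?as + 1" using cnf[OF x0] by (simp add: omega_pow_zero)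
      then show False using x is_limit_not_succ by blast
    qed
    then have a: "0 < ?a" by (simp add: pos_iff_neq_zero)
    \<comment> \<open>Addition is continuous on the right, so \<open>y\<close> is already exceeded
      with some \<open>z\<close> below the last power.\<close>
    have "y < cnf ?as + omega_pow ?a" using y cnf[OF x0] by simp
    then obtain z where z: "z < omega_pow ?a" "y < cnf ?as + z"
      unfolding oplus_limit[OF is_limit_omega_pow[OF a]]
      using less_cSUP_iff[OF lessThan_omega1_nonempty[OF is_limit_omega_pow[OF a]]
          bdd_above_image_lessThan] by auto
    obtain N where N: "\<And>n. n \<ge> N \<Longrightarrow> z \<le> cnf (r ?a n)"
      using section_of_limit_eventually_greater[OF lam a z(1), of "r ?a"] r_ge by blast
    have "y \<le> sec x n" if "n \<ge> N" for n
      unfolding sec_def cnf_simps using z(2) oplus_mono[OF N[OF that], of "cnf ?as"] by simp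
    then show "\<exists>N. \<forall>n\<ge>N. y \<le> sec x n" by blast
  qed
  then show ?thesis by blast
qed

section \<open>Ramsey property and completeness\<close>

context schreier_sections
begin

lemma schreier_mem_nonempty_iff:
  assumes "0 < x"
  shows "schreier_mem lam x s \<longleftrightarrow>
    (\<exists>n t. 1 \<le> n \<and> (\<forall>k\<in>t. n < k) \<and> s = insert n t \<and> schreier_mem lam (sec x n) t)"
proof
  assume mem: "schreier_mem lam x s"
  then have s: "finite s" "s \<noteq> {}" "s \<subseteq> posnats"
    using schreier_mem_finite[OF mem] assms by auto
  define n where "n = Min s"
  have "n \<in> s" "\<forall>k\<in>s - {n}. n < k" using s by (auto simp: n_def less_le)
  moreover from this have "1 \<le> n" "insert n (s - {n}) = s" using s by auto
  ultimately show "\<exists>n t. 1 \<le> n \<and> (\<forall>k\<in>t. n < k) \<and> s = insert n t \<and> schreier_mem lam (sec x n) t"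
    using schreier_mem_insert[OF assms, of n "s - {n}"] mem
    by (intro exI[of _ n] exI[of _ "s - {n}"]) simp
qed (use schreier_mem_insert assms in blast)

text \<open>Remove the minimum \<open>n\<close> of \<open>L\<close> and continue with the smaller
  index \<open>sec x n\<close>. The elements removed until the index is 0 form the required initial
  segment.\<close>

lemma schreier_complete:
  assumes "infinite L" "L \<subseteq> posnats"
  shows "\<exists>s. schreier_mem lam x s \<and> s \<subseteq> L \<and> initial_segment s L"
  using assms
proof (induction x arbitrary: L rule: less_induct)
  case (less x)
  show ?case
  proof (cases "x = 0")
    case True
    then show ?thesis by (intro exI[of _ "{}"]) (simp add: initial_segment_def)
  next
    case False
    then have x: "0 < x" by (simp add: pos_iff_neq_zero)
    define n where "n = Inf L"
    have "L \<noteq> {}" using less.prems by auto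
    then have n: "n \<in> L" "\<forall>k\<in>L. n \<le> k" unfolding n_def by (auto intro: Inf_nat_def1 wellorder_Inf_le1)
    then have n1: "1 \<le> n" using less.prems by auto
    obtain s where s: "schreier_mem lam (sec x n) s" "s \<subseteq> L - {n}" "initial_segment s (L - {n})"
      using less.IH[OF sec_less[OF x n1], of "L - {n}"] less.prems by auto
    have "\<forall>k\<in>s. n < k" using s(2) n by (auto simp: less_le)
    then have "schreier_mem lam x (insert n s)" using schreier_mem_insert[OF x n1] s(1) by blast
    moreover have "initial_segment (insert n s) L"
      using s n by (auto simp: initial_segment_def)
    ultimately show ?thesis using s(2) n by (intro exI[of _ "insert n s"]) auto
  qed
qed

text \<open>Successive thinning makes membership in \<open>F\<close> depend on the minimum alone; a
  pigeonhole argument on the minima then makes it constant.\<close>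

lemma schreier_Ramsey:
  assumes "infinite M" "M \<subseteq> posnats"
  shows "\<exists>L\<subseteq>M. infinite L \<and>
    ((\<forall>s. schreier_mem lam x s \<and> s \<subseteq> L \<longrightarrow> s \<in> F) \<or>
     (\<forall>s. schreier_mem lam x s \<and> s \<subseteq> L \<longrightarrow> s \<notin> F))"
  using assms
proof (induction x arbitrary: M F rule: less_induct)
  case (less x)
  show ?case
  proof (cases "x = 0")
    case True
    then show ?thesis using less.prems by (intro exI[of _ M]) auto
  next
    case False
    then have x: "0 < x" by (simp add: pos_iff_neq_zero)
    define hom where "hom n L c \<longleftrightarrow>
      (\<forall>s. schreier_mem lam (sec x n) s \<and> s \<subseteq> L \<longrightarrow> (insert n s \<in> F \<longleftrightarrow> c))" for n L c
    define good where "good K \<longleftrightarrow> infinite K \<and> K \<subseteq> M" for K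
    have step: "\<exists>L c. L \<subseteq> K - {Inf K} \<and> infinite L \<and> hom (Inf K) L c" if "good K" for K
    proof -
      have "Inf K \<in> K" using that unfolding good_def by (metis Inf_nat_def1 finite.emptyI)
      then have K: "1 \<le> Inf K" "infinite (K - {Inf K})" "K - {Inf K} \<subseteq> posnats"
        using that less.prems by (auto simp: good_def)
      \<comment> \<open>The induction hypothesis is applied to the section of \<open>F\<close> at
        the minimum, which is why \<open>F\<close> varies in the induction.\<close>
      obtain L where L: "L \<subseteq> K - {Inf K}" "infinite L" and
        "(\<forall>s. schreier_mem lam (sec x (Inf K)) s \<and> s \<subseteq> L \<longrightarrow> s \<in> {s. insert (Inf K) s \<in> F}) \<or>
         (\<forall>s. schreier_mem lam (sec x (Inf K)) s \<and> s \<subseteq> L \<longrightarrow> s \<notin> {s. insert (Inf K) s \<in> F})"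
        using less.IH[OF sec_less[OF x K(1)] K(2,3), of "{s. insert (Inf K) s \<in> F}"] by blast
      then have "hom (Inf K) L True \<or> hom (Inf K) L False" by (simp add: hom_def)
      then show ?thesis using L by blast
    qed
    then obtain nxt col where nxt: "\<And>K. good K \<Longrightarrow> nxt K \<subseteq> K - {Inf K}"
      "\<And>K. good K \<Longrightarrow> infinite (nxt K)" "\<And>K. good K \<Longrightarrow> hom (Inf K) (nxt K) (col K)"
      by metis
    \<comment> \<open>Each stage is homogeneous for the minimum of the stage before; the minima form
      the diagonal set.\<close>
    define K where "K i = (nxt ^^ i) M" for i
    have K_Suc: "K (Suc i) = nxt (K i)" for i by (simp add: K_def)
    have good: "good (K i)" for i
    proof (induction i)
      case 0
      then show ?case using less.prems by (simp add: K_def good_def)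
    next
      case (Suc i)
      then show ?case using nxt[of "K i"] unfolding K_Suc good_def by blast
    qed
    define a where "a i = Inf (K i)" for i
    have a_in: "a i \<in> K i" for i
      unfolding a_def using good[of i] unfolding good_def by (metis Inf_nat_def1 finite.emptyI)
    have K_anti: "K j \<subseteq> K i" if "i \<le> j" for i j
      by (rule lift_Suc_antimono_le[OF _ that]) (use nxt(1)[OF good] K_Suc in blast)
    have a_less: "a i < a j" if "i < j" for i j
    proof -
      have "a j \<in> nxt (K i)" using K_anti[of "Suc i" j] a_in[of j] that K_Suc by auto
      then have "a j \<in> K i" "a j \<noteq> a i" using nxt(1)[OF good[of i]] by (auto simp: a_def)
      then show ?thesis using wellorder_Inf_le1[of "a j" "K i"] by (simp add: a_def less_le)
    qed
    then have "strict_mono a" by (simp add: strict_mono_def)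
    then have inj: "inj a" by (rule strict_mono_imp_inj_on)
    \<comment> \<open>There are only two colours, so one of them occurs at infinitely many
      stages.\<close>
    obtain c where c: "infinite {i. col (K i) = c}"
      using inf_img_fin_dom[of "\<lambda>i. col (K i)" "UNIV :: nat set"] by (auto simp: vimage_def)
    define L where "L = a ` {i. col (K i) = c}"
    have L: "infinite L" "L \<subseteq> M"
      using c inj a_in good
      by (auto simp: L_def good_def dest: finite_imageD[OF _ inj_on_subset[OF inj subset_UNIV]])
    have "s \<in> F \<longleftrightarrow> c" if s: "schreier_mem lam x s" "s \<subseteq> L" for s
    proof -
      obtain n t where nt: "1 \<le> n" "\<forall>k\<in>t. n < k" "s = insert n t" "schreier_mem lam (sec x n) t"
        using s(1) schreier_mem_nonempty_iff[OF x] by blast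
      obtain i where i: "n = a i" "col (K i) = c" using nt(3) s(2) by (auto simp: L_def)
      \<comment> \<open>Later diagonal points lie in later stages, so everything after the minimum
        \<open>a i\<close> stays inside the set that is homogeneous for it.\<close>
      have "t \<subseteq> nxt (K i)"
      proof
        fix k assume k: "k \<in> t"
        then obtain j where j: "k = a j" using nt(3) s(2) by (auto simp: L_def)
        then have "i < j" using nt(2) k i a_less[of j i] by (metis linorder_neqE_nat less_asym order_less_irrefl)
        then show "k \<in> nxt (K i)" using K_anti[of "Suc i" j] a_in[of j] j K_Suc by auto
      qed
      then show ?thesis using nxt(3)[OF good[of i]] nt i unfolding hom_def a_def by blast
    qed
    then show ?thesis using L by (intro exI[of _ L]) blast
  qed
qed

end

section \<open>Closed hereditary families and the strong Cantor-Bendixson derivative\<close>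

lemma hereditaryD: "hereditary G \<Longrightarrow> s \<in> G \<Longrightarrow> t \<subseteq> s \<Longrightarrow> t \<in> G"
  by (auto simp: hereditary_def)

section \<open>Pointwise convergence of sets of naturals\<close>

lemma chi_eq_iff [simp]: "chi s = chi t \<longleftrightarrow> s = t"
  by (auto simp: chi_def fun_eq_iff)

lemma chi_in_image_iff [simp]: "chi s \<in> chi ` G \<longleftrightarrow> s \<in> G"
  by auto

text \<open>A basic neighbourhood restricts finitely many coordinates, and \<open>N\<close> bounds
  them.\<close>

lemma open_chi_agree_below:
  assumes "open U" "chi s \<in> U"
  shows "\<exists>N. \<forall>t. (\<forall>k<N. k \<in> t \<longleftrightarrow> k \<in> s) \<longrightarrow> chi t \<in> U"
proof -
  have "openin (product_topology (\<lambda>_. euclidean) UNIV) U" using assms(1) by (simp add: open_fun_def)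
  then obtain X where X: "chi s \<in> PiE UNIV X" "finite {i. X i \<noteq> UNIV}" "PiE UNIV X \<subseteq> U"
    using product_topology_open_contains_basis[of "\<lambda>_. euclidean" UNIV U "chi s"] assms(2) by auto
  obtain N where N: "\<And>i. X i \<noteq> UNIV \<Longrightarrow> i < N"
    using X(2) unfolding finite_nat_set_iff_bounded by blast
  have "chi t \<in> U" if "\<forall>k<N. k \<in> t \<longleftrightarrow> k \<in> s" for t
  proof -
    have "chi t i \<in> X i" for i
    proof (cases "X i = UNIV")
      case False
      then have "chi t i = chi s i" using N that by (simp add: chi_def)
      then show ?thesis using X(1) by (simp add: PiE_iff)
    qed simp
    then show ?thesis using X(3) by (auto simp: PiE_iff)
  qed
  then show ?thesis by blast
qed

lemma open_superset_nbhd: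
  assumes "finite K" shows "open {f :: nat \<Rightarrow> bool. \<forall>k\<in>K. f k}"
proof -
  have "open {f :: nat \<Rightarrow> bool. f k}" for k
    using open_vimage[OF open_discrete, of "\<lambda>f. f k" "{True}"] by (simp add: vimage_def)
  moreover have "{f :: nat \<Rightarrow> bool. \<forall>k\<in>K. f k} = (\<Inter>k\<in>K. {f. f k})" by auto
  ultimately show ?thesis using open_INT[OF assms, of "\<lambda>k. {f. f k}"] by simp
qed

text \<open>Take a limit point \<open>L\<close> outside the family. Every finite
  \<open>K \<subseteq> L\<close> is contained in some member close to \<open>L\<close>, so it
  belongs to \<open>G\<close> by heredity.\<close>

lemma not_pointwise_closed_hereditary:
  assumes "hereditary G" "\<not> pointwise_closed G"
  shows "\<exists>L. L \<notin> G \<and> Fpow L \<subseteq> G"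
proof -
  obtain f where f: "f islimpt (chi ` G)" "f \<notin> chi ` G"
    using assms(2) unfolding pointwise_closed_def closed_limpt by blast
  define L where "L = {k. f k}"
  have "f = chi L" by (simp add: L_def chi_def)
  then have "L \<notin> G" using f(2) by simp
  moreover have "K \<in> G" if K: "K \<subseteq> L" "finite K" for K
  proof -
    have "f \<in> {f. \<forall>k\<in>K. f k}" using K(1) by (auto simp: L_def)
    then obtain t where "t \<in> G" "\<forall>k\<in>K. chi t k"
      using f(1) open_superset_nbhd[OF K(2)] unfolding islimpt_def by blast
    then show ?thesis using hereditaryD[OF assms(1)] by (auto simp: chi_def)
  qed
  ultimately show ?thesis by (auto simp: Fpow_def)
qed

text \<open>\<open>L\<close> is the limit of its truncations
  \<open>L \<inter> {..<N}\<close>.\<close>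

lemma pointwise_closed_Fpow_subset:
  assumes "pointwise_closed G" "Fpow L \<subseteq> G" shows "L \<in> G"
proof (rule ccontr)
  assume "L \<notin> G"
  then have "chi L \<in> - (chi ` G)" by simp
  then obtain N where N: "\<And>t. \<forall>k<N. k \<in> t \<longleftrightarrow> k \<in> L \<Longrightarrow> chi t \<in> - (chi ` G)"
    using open_chi_agree_below[of "- (chi ` G)" L] assms(1) by (auto simp: pointwise_closed_def open_Compl)
  have "L \<inter> {..<N} \<in> G" using assms(2) by (auto simp: Fpow_def)
  then show False using N[of "L \<inter> {..<N}"] by simp
qed

text \<open>Replaces the topology by one-point extensions. If infinitely many \<open>k\<close> were
  exceptional, test with \<open>I\<close> the set of these: a member near \<open>s\<close> and
  different from it would contain \<open>s\<close> and an exceptional point, against heredity.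
  Otherwise a large nonexceptional \<open>k\<close> in \<open>I\<close> gives
  \<open>insert k s\<close> arbitrarily near \<open>s\<close>.\<close>

lemma scb_step_iff:
  assumes "hereditary H"
  shows "s \<in> scb_step L H \<longleftrightarrow> s \<in> H \<and> s \<in> Fpow L \<and> finite {k\<in>L. insert k s \<notin> H}"
proof (intro iffI conjI)
  assume s: "s \<in> scb_step L H"
  then show H: "s \<in> H" and L: "s \<in> Fpow L" by (auto simp: scb_step_def)
  show "finite {k\<in>L. insert k s \<notin> H}"
  proof (rule ccontr)
    let ?I = "{k\<in>L. insert k s \<notin> H}"
    assume "infinite ?I"
    then have "chi s islimpt (chi ` (H \<inter> Fpow (s \<union> ?I)))"
      using s by (auto simp: scb_step_def inf_subsets_def cluster_point_def)
    moreover have "chi s \<in> {f. \<forall>k\<in>s. f k}" "open {f :: nat \<Rightarrow> bool. \<forall>k\<in>s. f k}"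
      using L open_superset_nbhd[of s] by (auto simp: chi_def Fpow_def)
    ultimately obtain f where "f \<in> chi ` (H \<inter> Fpow (s \<union> ?I))" "f \<in> {f. \<forall>k\<in>s. f k}" "f \<noteq> chi s"
      by (rule islimptE)
    then obtain t where "f = chi t" "t \<in> H" "t \<in> Fpow (s \<union> ?I)" by blast
    with \<open>f \<in> {f. \<forall>k\<in>s. f k}\<close> \<open>f \<noteq> chi s\<close>
    have t: "t \<in> H" "t \<subseteq> s \<union> ?I" "s \<subseteq> t" "t \<noteq> s"
      by (auto simp: chi_def Fpow_def)
    then obtain k where "k \<in> t" "k \<in> ?I" by blast
    moreover from this have "insert k s \<in> H" using t hereditaryD[OF assms t(1)] by blast
    ultimately show False by simp
  qed
next
  assume s: "s \<in> H \<and> s \<in> Fpow L \<and> finite {k\<in>L. insert k s \<notin> H}"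
  have "cluster_point s (H \<inter> Fpow (s \<union> I))" if I: "I \<in> inf_subsets L" for I
    unfolding cluster_point_def
  proof (rule islimptI)
    fix U assume U: "chi s \<in> U" "open U"
    obtain N where N: "\<And>t. \<forall>k<N. k \<in> t \<longleftrightarrow> k \<in> s \<Longrightarrow> chi t \<in> U"
      using open_chi_agree_below[OF U(2,1)] by blast
    have "infinite (I - ({k\<in>L. insert k s \<notin> H} \<union> s \<union> {..<N}))"
      using s I by (intro Diff_infinite_finite) (auto simp: Fpow_def inf_subsets_def)
    then obtain k where "k \<in> I - ({k\<in>L. insert k s \<notin> H} \<union> s \<union> {..<N})"
      using infinite_imp_nonempty by blast
    then have k: "k \<in> I" "k \<notin> s" "N \<le> k" "insert k s \<in> H"
      using I by (auto simp: inf_subsets_def)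
    have "chi (insert k s) \<in> U" using k(3) by (intro N) auto
    moreover have "insert k s \<in> H \<inter> Fpow (s \<union> I)" using k s by (auto simp: Fpow_def)
    ultimately show "\<exists>y\<in>chi ` (H \<inter> Fpow (s \<union> I)). y \<in> U \<and> y \<noteq> chi s"
      using k(2) by (intro bexI[of _ "chi (insert k s)"]) auto
  qed
  then show "s \<in> scb_step L H" using s by (simp add: scb_step_def)
qed

lemma hereditary_scb_step: "hereditary H \<Longrightarrow> hereditary (scb_step L H)"
  unfolding hereditary_def[of "scb_step L H"]
proof (intro ballI allI impI)
  fix s t assume H: "hereditary H" and s: "s \<in> scb_step L H" and t: "t \<subseteq> s"
  have "{k\<in>L. insert k t \<notin> H} \<subseteq> {k\<in>L. insert k s \<notin> H}"
    using hereditaryD[OF H _ insert_mono[OF t]] by blast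
  then show "t \<in> scb_step L H"
    using s t hereditaryD[OF H] unfolding scb_step_iff[OF H]
    by (auto simp: Fpow_def intro: finite_subset)
qed

section \<open>Iterated derivatives of hereditary families\<close>

lemma scb_deriv_zero [simp]: "scb_deriv L G 0 = G"
  by (simp add: scb_deriv.simps)

lemma scb_deriv_osuc: "scb_deriv L G (osuc x) = scb_step L (scb_deriv L G x)"
  using scb_deriv_add_one by (simp add: oplus_one)

lemma one_le_iff_pos: "1 \<le> x \<longleftrightarrow> 0 < (x :: omega1)"
  by (simp add: one_omega1_def osuc_le_iff)

lemma scb_deriv_antimono: "y \<le> x \<Longrightarrow> scb_deriv L G x \<subseteq> scb_deriv L G y"
proof (induction x arbitrary: y rule: less_induct)
  case (less x)
  show ?case
  proof (cases x rule: omega1_cases)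
    case zero
    then show ?thesis using less.prems by (metis omega1_zero_le order.antisym order.refl)
  next
    case (succ w)
    have "scb_deriv L G x \<subseteq> scb_deriv L G w" by (auto simp: succ scb_deriv_osuc scb_step_def)
    moreover have "y = x \<or> y \<le> w" using less.prems succ by (auto simp: order.order_iff_strict less_osuc_iff)
    ultimately show ?thesis using less.IH[of w y] succ by auto
  next
    case limit
    have one: "1 < x" using is_limit_osuc_less[OF limit is_limit_pos[OF limit]] by (simp add: one_omega1_def)
    consider "y = x" | "y = 0" | "y < x" "1 \<le> y"
      using less.prems one_le_iff_pos pos_iff_neq_zero order.order_iff_strict by metis
    then show ?thesis
    proof cases
      case 2
      \<comment> \<open>The intersection at a limit starts at index 1, so the auxiliary index 0 is
        reached through 1.\<close>
      have "scb_deriv L G x \<subseteq> scb_deriv L G 1"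
        unfolding scb_deriv_limit[OF limit] using one by auto
      also have "\<dots> \<subseteq> G" by (auto simp: scb_deriv_one scb_step_def)
      finally show ?thesis using 2 by simp
    next
      case 3
      then show ?thesis unfolding scb_deriv_limit[OF limit] by auto
    qed simp
  qed
qed

lemma scb_deriv_subset: "scb_deriv L G x \<subseteq> G"
  using scb_deriv_antimono[of 0 x L G] by simp

lemma scb_deriv_limit_iff:
  assumes "is_limit x" shows "s \<in> scb_deriv L G x \<longleftrightarrow> (\<forall>y<x. s \<in> scb_deriv L G y)"
proof
  show "\<forall>y<x. s \<in> scb_deriv L G y" if "s \<in> scb_deriv L G x"
    using that scb_deriv_antimono less_imp_le by blast
qed (simp add: scb_deriv_limit[OF assms])

lemma hereditary_scb_deriv:
  assumes "hereditary G" shows "hereditary (scb_deriv L G x)"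
proof (induction x rule: less_induct)
  case (less x)
  show ?case
  proof (cases x rule: omega1_cases)
    case (succ w)
    then show ?thesis using less[of w] by (simp add: scb_deriv_osuc hereditary_scb_step)
  next
    case limit
    have "t \<in> scb_deriv L G x" if "s \<in> scb_deriv L G x" "t \<subseteq> s" for s t
      using that hereditaryD[OF less, of _ s t] by (simp add: scb_deriv_limit_iff[OF limit])
    then show ?thesis by (auto simp: hereditary_def)
  qed (use assms in simp)
qed

lemma scb_deriv_osuc_iff:
  assumes "hereditary G"
  shows "s \<in> scb_deriv L G (osuc x) \<longleftrightarrow>
    s \<in> scb_deriv L G x \<and> s \<in> Fpow L \<and> finite {k\<in>L. insert k s \<notin> scb_deriv L G x}"
  unfolding scb_deriv_osuc by (rule scb_step_iff[OF hereditary_scb_deriv[OF assms]])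

text \<open>Trades one derivative for one more element: all but finitely many points of the infinite
  set \<open>L\<close> can be added.\<close>

lemma scb_deriv_osuc_infinite_ex:
  assumes "hereditary G" "infinite L" "s \<in> scb_deriv L G (osuc x)"
  shows "\<exists>k\<in>L. k \<notin> s \<and> insert k s \<in> scb_deriv L G x"
proof -
  have "finite ({k\<in>L. insert k s \<notin> scb_deriv L G x} \<union> s)"
    using assms(3) by (simp add: scb_deriv_osuc_iff[OF assms(1)] Fpow_def)
  then have "L - ({k\<in>L. insert k s \<notin> scb_deriv L G x} \<union> s) \<noteq> {}"
    using assms(2) Diff_infinite_finite by (metis finite.emptyI)
  then show ?thesis by blast
qed

text \<open>Passing to a smaller \<open>L'\<close> leaves fewer points that could be exceptional, so
  a set inside \<open>L'\<close> survives at least as long.\<close>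

lemma scb_deriv_subset_mono:
  assumes "hereditary G" "L' \<subseteq> L" "s \<subseteq> L'" "s \<in> scb_deriv L G x"
  shows "s \<in> scb_deriv L' G x"
  using assms(3,4)
proof (induction x arbitrary: s rule: less_induct)
  case (less x)
  show ?case
  proof (cases x rule: omega1_cases)
    case zero
    then show ?thesis using less.prems by simp
  next
    case (succ w)
    have "{k\<in>L'. insert k s \<notin> scb_deriv L' G w} \<subseteq> {k\<in>L. insert k s \<notin> scb_deriv L G w}"
      using less succ assms(2) by auto
    then show ?thesis using less succ
      by (auto simp: scb_deriv_osuc_iff[OF assms(1)] Fpow_def intro: finite_subset)
  next
    case limit
    then show ?thesis using less by (simp add: scb_deriv_limit_iff)
  qed
qed

lemma scb_deriv_empty_iff:
  assumes "hereditary G" shows "scb_deriv L G x = {} \<longleftrightarrow> {} \<notin> scb_deriv L G x"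
  using hereditaryD[OF hereditary_scb_deriv[OF assms]] by blast

text \<open>The counterpart for arbitrary families of the passage from \<open>x\<close> to
  \<open>sec x n\<close>.\<close>

definition section_family :: "nat \<Rightarrow> nat set set \<Rightarrow> nat set set" where
  "section_family n G = {s. (\<forall>k\<in>s. n < k) \<and> insert n s \<in> G}"

lemma hereditary_section_family: "hereditary G \<Longrightarrow> hereditary (section_family n G)"
  unfolding hereditary_def section_family_def by (auto, metis insert_mono)

text \<open>The exceptional sets on the two sides differ only by points up to \<open>n\<close>, and
  finitely many points do not affect finiteness.\<close>

lemma scb_deriv_section_family:
  assumes G: "hereditary G" and n: "n \<in> L" and s: "\<forall>k\<in>s. n < k"
  shows "insert n s \<in> scb_deriv L G x \<longleftrightarrow> s \<in> scb_deriv (L \<inter> {n<..}) (section_family n G) x"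
  using s
proof (induction x arbitrary: s rule: less_induct)
  case (less x)
  let ?L = "L \<inter> {n<..}" and ?G = "section_family n G"
  show ?case
  proof (cases x rule: omega1_cases)
    case zero
    then show ?thesis using less.prems by (simp add: section_family_def)
  next
    case (succ w)
    let ?A = "{k\<in>L. insert k (insert n s) \<notin> scb_deriv L G w}"
      and ?B = "{k\<in>?L. insert k s \<notin> scb_deriv ?L ?G w}"
    have IH: "insert k (insert n s) \<in> scb_deriv L G w \<longleftrightarrow> insert k s \<in> scb_deriv ?L ?G w"
      if "n < k" for k
      using less.IH[of w "insert k s"] succ that less.prems by (simp add: insert_commute)
    have "?B \<subseteq> ?A" "?A \<subseteq> ?B \<union> {..n}" using IH by auto
    then have "finite ?A \<longleftrightarrow> finite ?B" by (meson finite_Un finite_atMost finite_subset)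
    moreover have "insert n s \<in> Fpow L \<longleftrightarrow> s \<in> Fpow ?L"
      using n less.prems by (auto simp: Fpow_def)
    ultimately show ?thesis
      using less.IH[of w s] less.prems succ
      by (simp add: scb_deriv_osuc_iff[OF G] scb_deriv_osuc_iff[OF hereditary_section_family[OF G]])
  next
    case limit
    then show ?thesis using less by (simp add: scb_deriv_limit_iff)
  qed
qed

text \<open>The union of an infinite strictly increasing chain has all its finite subsets in
  \<open>G\<close> by heredity, so closedness puts the union itself into \<open>G\<close>, whose
  members are finite.\<close>

lemma wf_supsets_in_closed_family:
  assumes "hereditary G" "pointwise_closed G" "G \<subseteq> Collect finite"
  shows "wf {(t, s). t \<in> G \<and> s \<subset> t}"
proof (subst wf_iff_no_infinite_down_chain, rule notI, elim exE)
  fix f assume "\<forall>i. (f (Suc i), f i) \<in> {(t, s). t \<in> G \<and> s \<subset> t}"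
  then have f: "f (Suc i) \<in> G" "f i \<subset> f (Suc i)" for i by auto
  define L where "L = (\<Union>i. f i)"
  have mono: "f i \<subseteq> f j" if "i \<le> j" for i j
    by (rule lift_Suc_mono_le[OF _ that]) (use f(2) in blast)
  have "K \<in> G" if K: "finite K" "K \<subseteq> L" for K
  proof -
    have "\<exists>i. K \<subseteq> f i" using K
    proof (induction K rule: finite_induct)
      case (insert k K)
      then obtain i j where "K \<subseteq> f i" "k \<in> f j" by (auto simp: L_def)
      then have "insert k K \<subseteq> f (max i j)" using mono[of i "max i j"] mono[of j "max i j"] by auto
      then show ?case by blast
    qed simp
    then obtain i where "K \<subseteq> f (Suc i)" using f(2) by blast
    then show ?thesis using hereditaryD[OF assms(1) f(1)] by blast
  qed
  then have "L \<in> G" by (intro pointwise_closed_Fpow_subset assms) (auto simp: Fpow_def)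
  then have "finite (Pow L)" using assms(3) by auto
  moreover have "range f \<subseteq> Pow L" by (auto simp: L_def)
  moreover have "inj f"
    using lift_Suc_mono_less[of f] f(2) by (auto intro!: linorder_injI)
  ultimately show False by (meson finite_subset infinite_UNIV_nat finite_imageD)
qed

text \<open>Strict supersets inside a closed family of finite sets form a well-founded tree with countably many
  nodes. Its rank bounds the derivatives for all of the uncountably many \<open>L\<close> at once.\<close>

lemma scb_deriv_uniform_bound:
  assumes G: "hereditary G" "pointwise_closed G" "G \<subseteq> Collect finite"
  shows "\<exists>x. \<forall>L. infinite L \<longrightarrow> s \<notin> scb_deriv L G x"
proof (induction s rule: wf_induct_rule[OF wf_supsets_in_closed_family[OF G]])
  case (1 s)
  then have ex: "\<exists>x. \<forall>L. infinite L \<longrightarrow> t \<notin> scb_deriv L G x" if "t \<in> G" "s \<subset> t" for t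
    using that by blast
  define h where "h t = (SOME x. \<forall>L. infinite L \<longrightarrow> t \<notin> scb_deriv L G x)" for t
  have h: "t \<notin> scb_deriv L G (h t)" if "t \<in> G" "s \<subset> t" "infinite L" for t L
    using someI_ex[OF ex[OF that(1,2)]] that(3) unfolding h_def by blast
  \<comment> \<open>There are only countably many finite sets of naturals, so the bounds chosen for
    the members have a common countable bound.\<close>
  have "countable (h ` G)"
    using countable_subset[OF G(3)] countable_Collect_finite by (intro countable_image) blast
  then have "bdd_above (h ` G)" by (rule omega1_bdd_above)
  then obtain u where "\<forall>x\<in>h ` G. x \<le> u" unfolding bdd_above_def ..
  then have u: "h t \<le> u" if "t \<in> G" for t using that by simp
  have "s \<notin> scb_deriv L G (osuc u)" if L: "infinite L" for L
  proof
    assume "s \<in> scb_deriv L G (osuc u)"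
    then obtain k where k: "k \<notin> s" "insert k s \<in> scb_deriv L G u"
      using scb_deriv_osuc_infinite_ex[OF G(1) L] by blast
    then have "insert k s \<in> G" using scb_deriv_subset by blast
    then have "insert k s \<in> scb_deriv L G (h (insert k s))"
      using k(2) scb_deriv_antimono[OF u] by blast
    then show False using h \<open>insert k s \<in> G\<close> k(1) L by blast
  qed
  then show ?case by blast
qed

lemma infinite_Int_greaterThan: "infinite L \<Longrightarrow> infinite (L \<inter> {n<..})" for L :: "nat set"
  using Diff_infinite_finite[of "{..n}" L] by (simp add: Diff_eq)

section \<open>Comparison of derivatives with Schreier families\<close>

context schreier_sections
begin

text \<open>The bound cannot be improved to \<open>x\<close> by this induction: at a limit \<open>x\<close> no single section index
  reaches \<open>x\<close>, only \<open>osuc (sec x n) \<le> x\<close> is available.\<close>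

lemma empty_notin_scb_deriv:
  assumes "hereditary G" "infinite L" "L \<subseteq> posnats"
    and "\<And>s. schreier_mem lam x s \<Longrightarrow> s \<subseteq> L \<Longrightarrow> s \<notin> G"
  shows "{} \<notin> scb_deriv L G (osuc x)"
  using assms
proof (induction x arbitrary: G L rule: less_induct)
  case (less x)
  show ?case
  proof (cases "x = 0")
    case True
    then show ?thesis using less.prems(4)[of "{}"] scb_deriv_subset by auto
  next
    case False
    then have x: "0 < x" by (simp add: pos_iff_neq_zero)
    show ?thesis
    proof
      assume "{} \<in> scb_deriv L G (osuc x)"
      \<comment> \<open>The extra derivative pays for a first point \<open>n\<close>; the remaining
        \<open>x\<close> derivatives suffice for the section at \<open>n\<close>.\<close>
      then obtain n where n: "n \<in> L" "insert n {} \<in> scb_deriv L G x"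
        using scb_deriv_osuc_infinite_ex[OF less.prems(1,2)] by blast
      have n1: "1 \<le> n" using n(1) less.prems(3) by auto
      have "osuc (sec x n) \<le> x" using sec_less[OF x n1] by (simp add: osuc_le_iff)
      then have "insert n {} \<in> scb_deriv L G (osuc (sec x n))"
        using n(2) scb_deriv_antimono by blast
      then have "{} \<in> scb_deriv (L \<inter> {n<..}) (section_family n G) (osuc (sec x n))"
        using scb_deriv_section_family[OF less.prems(1) n(1), of "{}"] by simp
      moreover have "s \<notin> section_family n G"
        if s: "schreier_mem lam (sec x n) s" "s \<subseteq> L \<inter> {n<..}" for s
      proof -
        have "schreier_mem lam x (insert n s)" using schreier_mem_insert[OF x n1] s by auto
        then show ?thesis using less.prems(4)[of "insert n s"] s n(1)
          by (auto simp: section_family_def)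
      qed
      moreover have "infinite (L \<inter> {n<..})"
        using less.prems(2) by (rule infinite_Int_greaterThan)
      ultimately show False
        using less.IH[OF sec_less[OF x n1] hereditary_section_family[OF less.prems(1)], of "L \<inter> {n<..}"]
          less.prems(3) by blast
    qed
  qed
qed

text \<open>Induction on sections shows how long singletons survive. At a successor all
  \<open>{n}\<close> with \<open>n \<in> L\<close> survive up to the predecessor, and one further
  derivative keeps \<open>{}\<close>. At a limit, for each \<open>y < x\<close> almost all sections
  have index at least \<open>y\<close>, so \<open>{}\<close> survives \<open>osuc y\<close>
  derivatives.\<close>

lemma empty_in_scb_deriv:
  assumes "hereditary G" "infinite L" "L \<subseteq> posnats"
    and "\<And>s. schreier_mem lam x s \<Longrightarrow> s \<subseteq> L \<Longrightarrow> s \<in> G"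
  shows "{} \<in> scb_deriv L G x"
  using assms
proof (induction x arbitrary: G L rule: less_induct)
  case (less x)
  \<comment> \<open>Stated for a general \<open>w\<close> to serve both the predecessor of a
    successor index and \<open>sec x n\<close> at a limit.\<close>
  have section_deriv: "{n} \<in> scb_deriv L G w" if w: "w < x" and n: "n \<in> L"
    and mem: "\<And>s. \<forall>k\<in>s. n < k \<Longrightarrow> schreier_mem lam w s \<Longrightarrow> schreier_mem lam x (insert n s)" for w n
  proof -
    have "s \<in> section_family n G" if s: "schreier_mem lam w s" "s \<subseteq> L \<inter> {n<..}" for s
      using less.prems(4)[of "insert n s"] mem[of s] s n by (auto simp: section_family_def)
    moreover have "infinite (L \<inter> {n<..})"
      using less.prems(2) by (rule infinite_Int_greaterThan)
    ultimately have "{} \<in> scb_deriv (L \<inter> {n<..}) (section_family n G) w"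
      using less.IH[OF w hereditary_section_family[OF less.prems(1)], of "L \<inter> {n<..}"]
        less.prems(3) by blast
    then show ?thesis
      using scb_deriv_section_family[OF less.prems(1) n, of "{}"] by simp
  qed
  show ?case
  proof (cases x rule: omega1_cases)
    case zero
    then show ?thesis using less.prems(4)[of "{}"] by simp
  next
    case (succ w)
    have "{n} \<in> scb_deriv L G w" if "n \<in> L" for n
    proof (rule section_deriv)
      fix s assume "\<forall>k\<in>s. n < k" "schreier_mem lam w s"
      then show "schreier_mem lam x (insert n s)"
        using schreier_mem.succ[of n s lam w] that less.prems(3) succ
        by (auto simp: oplus_one block_less_def)
    qed (use succ that in simp_all)
    then have in_w: "{k\<in>L. insert k {} \<notin> scb_deriv L G w} = {}" "\<exists>n. {n} \<in> scb_deriv L G w"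
      using less.prems(2) infinite_imp_nonempty by blast+
    then have "{} \<in> scb_deriv L G w"
      using hereditaryD[OF hereditary_scb_deriv[OF less.prems(1)]] by blast
    moreover have "finite {k\<in>L. insert k {} \<notin> scb_deriv L G w}" unfolding in_w(1) by simp
    ultimately show ?thesis
      using scb_deriv_osuc_iff[OF less.prems(1)] empty_in_Fpow unfolding succ by blast
  next
    case limit
    have x: "0 < x" using limit by (rule is_limit_pos)
    have "{} \<in> scb_deriv L G (osuc y)" if y: "y < x" for y
    proof -
      obtain N where N: "\<And>n. n \<ge> N \<Longrightarrow> y \<le> sec x n" using sec_eventually_ge[OF limit y] by blast
      have in_y: "{n} \<in> scb_deriv L G y" if "n \<in> L" "n \<ge> N" for n
      proof -
        have n1: "1 \<le> n" using that(1) less.prems(3) by auto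
        then have "{n} \<in> scb_deriv L G (sec x n)"
          using section_deriv[OF sec_less[OF x n1] that(1)] schreier_mem_insert[OF x n1] by blast
        then show ?thesis using scb_deriv_antimono[OF N[OF that(2)]] by blast
      qed
      then have "{k\<in>L. insert k {} \<notin> scb_deriv L G y} \<subseteq> {..<N}" by (auto simp: not_less[symmetric])
      moreover have "infinite (L - {..<N})" using less.prems(2) by (simp add: Diff_infinite_finite)
      then obtain n where "n \<in> L" "n \<ge> N" by (force dest!: infinite_imp_nonempty)
      then have "{} \<in> scb_deriv L G y"
        using hereditaryD[OF hereditary_scb_deriv[OF less.prems(1)] in_y] by blast
      ultimately show ?thesis
        by (auto simp: scb_deriv_osuc_iff[OF less.prems(1)] Fpow_def intro: finite_subset)
    qed
    then show ?thesis
      unfolding scb_deriv_limit_iff[OF limit] using scb_deriv_antimono less_osuc less_imp_le by blast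
  qed
qed

end

section \<open>The dichotomy\<close>

context schreier_sections
begin

text \<open>Completeness provides the passage to \<open>star\<close>. For \<open>s \<in> F\<close>,
  extend \<open>s\<close> by the tail of \<open>L\<close> and take an initial segment
  \<open>t\<close> of the result in the Schreier family. As \<open>t\<close> is not in
  \<open>F\<close>, it is not contained in \<open>s\<close>, so it runs past \<open>s\<close> and
  has \<open>s\<close> as an initial segment.\<close>

lemma schreier_avoiding_iff:
  assumes F: "hereditary F" "F \<subseteq> Fpow posnats" and L: "infinite L" "L \<subseteq> posnats"
  shows "schreier lam x \<inter> Fpow L \<subseteq> Fpow posnats - F \<longleftrightarrow>
    F \<inter> Fpow L \<subseteq> star (schreier lam x) - schreier lam x"
proof
  assume avoid: "schreier lam x \<inter> Fpow L \<subseteq> Fpow posnats - F"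
  show "F \<inter> Fpow L \<subseteq> star (schreier lam x) - schreier lam x"
  proof
    fix s assume s: "s \<in> F \<inter> Fpow L"
    then have fin: "finite s" "s \<subseteq> L" by (auto simp: Fpow_def)
    define I where "I = s \<union> {k\<in>L. \<forall>j\<in>s. j < k}"
    obtain N where "\<forall>j\<in>s. j < N" using fin(1) unfolding finite_nat_set_iff_bounded by blast
    then have "L \<subseteq> I \<union> {..<N}" by (force simp: I_def)
    then have "infinite I" using L(1) by (meson finite_Un finite_lessThan finite_subset)
    moreover have "I \<subseteq> L" using fin by (auto simp: I_def)
    ultimately obtain t where t: "schreier_mem lam x t" "t \<subseteq> I" "initial_segment t I"
      using schreier_complete[of I x] L(2) by blast
    have "finite t" using schreier_mem_finite[OF t(1)] by simp
    then have "t \<in> schreier lam x \<inter> Fpow L"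
      using t \<open>I \<subseteq> L\<close> by (auto simp: schreier_def Fpow_def)
    then have "t \<notin> F" using avoid by blast
    then have "\<not> t \<subseteq> s" using hereditaryD[OF F(1)] s by blast
    then obtain k where k: "k \<in> t" "k \<notin> s" by blast
    then have "\<forall>j\<in>s. j < k" using t(2) by (auto simp: I_def)
    moreover have "j \<in> t" if "j \<in> s" "j \<le> k" for j
      using t(3) k(1) that unfolding initial_segment_def I_def by blast
    ultimately have "s \<subseteq> t" using less_imp_le by blast
    then have "initial_segment s t" using t(2) by (force simp: initial_segment_def I_def)
    moreover have "s \<in> Fpow posnats" using fin L(2) by (auto simp: Fpow_def)
    ultimately have "s \<in> star (schreier lam x)"
      using t(1) by (auto simp: star_def schreier_def)
    moreover have "s \<notin> schreier lam x" using avoid s by blast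
    ultimately show "s \<in> star (schreier lam x) - schreier lam x" by blast
  qed
next
  assume "F \<inter> Fpow L \<subseteq> star (schreier lam x) - schreier lam x"
  moreover have "Fpow L \<subseteq> Fpow posnats" using L(2) by (rule Fpow_mono)
  ultimately show "schreier lam x \<inter> Fpow L \<subseteq> Fpow posnats - F" by blast
qed

lemma schreier_Ramsey_Fpow:
  assumes "M \<in> inf_subsets posnats"
  shows "\<exists>L\<in>inf_subsets M. schreier lam x \<inter> Fpow L \<subseteq> F \<or> schreier lam x \<inter> Fpow L \<subseteq> Fpow posnats - F"
proof -
  obtain L where L: "L \<subseteq> M" "infinite L"
    and *: "(\<forall>s. schreier_mem lam x s \<and> s \<subseteq> L \<longrightarrow> s \<in> F) \<or>
      (\<forall>s. schreier_mem lam x s \<and> s \<subseteq> L \<longrightarrow> s \<notin> F)"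
    using schreier_Ramsey[of M x F] assms by (auto simp: inf_subsets_def)
  have "Fpow L \<subseteq> Fpow posnats" using L assms by (intro Fpow_mono) (auto simp: inf_subsets_def)
  then show ?thesis using * L
    by (intro bexI[of _ L]) (auto simp: schreier_def Fpow_def inf_subsets_def)
qed

end

text \<open>The limit set outside the trace must be infinite, as otherwise it would be one of its
  own finite subsets. Its singletons show that it lies in \<open>M\<close>.\<close>

lemma pointwise_not_closed_dichotomy:
  assumes "hereditary F" "\<not> pointwise_closed (F \<inter> Fpow M)"
  shows "\<exists>L\<in>inf_subsets M. Fpow L \<subseteq> F"
proof -
  have "hereditary (F \<inter> Fpow M)"
    using assms(1) by (auto simp: hereditary_def Fpow_def dest: finite_subset)
  then obtain L where L: "L \<notin> F \<inter> Fpow M" "Fpow L \<subseteq> F \<inter> Fpow M"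
    using not_pointwise_closed_hereditary assms(2) by blast
  have "infinite L" using L by (auto simp: Fpow_def)
  moreover have "{k} \<in> Fpow M" if "k \<in> L" for k using L(2) that by (auto simp: Fpow_def)
  then have "L \<subseteq> M" by (auto simp: Fpow_def)
  ultimately show ?thesis using L(2) by (auto simp: inf_subsets_def)
qed

lemma pointwise_closed_subset_singleton_empty:
  assumes "H \<subseteq> {{}}" shows "pointwise_closed H"
proof (rule ccontr)
  assume "\<not> pointwise_closed H"
  moreover have "hereditary H" using assms by (auto simp: hereditary_def)
  ultimately obtain L where L: "L \<notin> H" "Fpow L \<subseteq> H"
    using not_pointwise_closed_hereditary by blast
  have "{k} \<in> {{}}" if "k \<in> L" for k using that L(2) assms by (auto simp: Fpow_def)
  then have "L = {}" by blast
  then show False using L empty_in_Fpow by blast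
qed

lemma scb_index_eq_one: "scb_deriv L G 1 = {} \<Longrightarrow> scb_index L G = 1"
  unfolding scb_index_def by (intro Least_equality) auto

text \<open>Evaluates the index for the two example families. They have no nonempty members, so
  every point of \<open>L\<close> is exceptional and nothing survives one derivative.\<close>

lemma scb_sup_eq_one:
  assumes "F \<subseteq> {{}}" "M \<in> inf_subsets posnats"
  shows "scb_sup M F = 0 + 1"
proof -
  have "scb_index L (F \<inter> Fpow M) = 1" if L: "L \<in> inf_subsets M" for L
  proof (rule scb_index_eq_one)
    have G: "hereditary (F \<inter> Fpow M)" using assms(1) by (auto simp: hereditary_def)
    have "{k\<in>L. insert k s \<notin> F \<inter> Fpow M} = L" for s using assms(1) by auto
    then show "scb_deriv L (F \<inter> Fpow M) 1 = {}"
      using L unfolding scb_deriv_one by (auto simp: scb_step_iff[OF G] inf_subsets_def)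
  qed
  moreover have "inf_subsets M \<noteq> {}" using assms(2) by (auto simp: inf_subsets_def)
  ultimately show ?thesis by (simp add: scb_sup_def)
qed

section \<open>Closed traces\<close>

locale closed_hereditary_trace = schreier_sections +
  fixes F :: "nat set set" and M :: "nat set"
  assumes F: "F \<subseteq> Fpow posnats" "hereditary F"
    and M: "M \<in> inf_subsets posnats"
    and closed: "pointwise_closed (F \<inter> Fpow M)"
begin

abbreviation "G \<equiv> F \<inter> Fpow M"

lemma hereditary_G: "hereditary G"
  using F(2) by (auto simp: hereditary_def Fpow_def dest: finite_subset)

lemma inf_subsets_M: "L \<in> inf_subsets M \<Longrightarrow> infinite L \<and> L \<subseteq> M \<and> L \<subseteq> posnats"
  using M by (auto simp: inf_subsets_def)

lemma inf_subsets_posnats: "L \<in> inf_subsets M \<Longrightarrow> L \<in> inf_subsets posnats"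
  using M by (auto simp: inf_subsets_def)

text \<open>One ordinal serves all \<open>L\<close> at once, which is what bounds the supremum. The
  maximum with 1 respects the convention that the index is at least 1.\<close>

lemma scb_deriv_eventually_empty: "\<exists>x\<ge>1. \<forall>L\<in>inf_subsets M. scb_deriv L G x = {}"
proof -
  obtain u where u: "\<forall>L. infinite L \<longrightarrow> {} \<notin> scb_deriv L G u"
    using scb_deriv_uniform_bound[OF hereditary_G closed] by (auto simp: Fpow_def)
  have "scb_deriv L G (max 1 u) = {}" if "L \<in> inf_subsets M" for L
    using u that inf_subsets_M scb_deriv_antimono[of u "max 1 u" L G]
    unfolding scb_deriv_empty_iff[OF hereditary_G] by auto
  then show ?thesis by (intro exI[of _ "max 1 u"]) simp
qed

lemma bdd_above_scb_index: "bdd_above ((\<lambda>L. scb_index L G) ` inf_subsets M)"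
proof -
  obtain x where "1 \<le> x" "\<forall>L\<in>inf_subsets M. scb_deriv L G x = {}"
    using scb_deriv_eventually_empty by blast
  then have "scb_index L G \<le> x" if "L \<in> inf_subsets M" for L
    unfolding scb_index_def using that by (intro Least_le) simp
  then show ?thesis by (rule bdd_aboveI2)
qed

lemma scb_deriv_scb_index:
  assumes "L \<in> inf_subsets M" shows "scb_deriv L G (scb_index L G) = {}"
proof -
  obtain x where "1 \<le> x \<and> scb_deriv L G x = {}"
    using scb_deriv_eventually_empty assms by blast
  then have "1 \<le> scb_index L G \<and> scb_deriv L G (scb_index L G) = {}"
    unfolding scb_index_def by (rule LeastI)
  then show ?thesis ..
qed

text \<open>On some \<open>L\<close> the empty set survives \<open>x + 1\<close> derivatives, and so
  it does on every infinite subset. The Ramsey alternative of avoidance would destroy it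
  there.\<close>

lemma schreier_subset_if_sup_greater:
  assumes "scb_sup M F > x + 1"
  shows "\<exists>L\<in>inf_subsets M. schreier lam x \<inter> Fpow L \<subseteq> F"
proof -
  have "inf_subsets M \<noteq> {}" using M by (auto simp: inf_subsets_def)
  then obtain L where L: "L \<in> inf_subsets M" "osuc x < scb_index L G"
    using assms less_cSUP_iff[OF _ bdd_above_scb_index] by (auto simp: scb_sup_def oplus_one)
  \<comment> \<open>The index is least only among ordinals that are at least 1, so minimality
    applies only after this check.\<close>
  have "1 \<le> osuc x" by (simp add: one_le_iff_pos pos_iff_neq_zero)
  then have "scb_deriv L G (osuc x) \<noteq> {}"
    using not_less_Least[OF L(2)[unfolded scb_index_def]] by simp
  then have ne: "{} \<in> scb_deriv L G (osuc x)"
    by (simp add: scb_deriv_empty_iff[OF hereditary_G])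
  obtain K where K: "K \<in> inf_subsets L"
    "schreier lam x \<inter> Fpow K \<subseteq> F \<or> schreier lam x \<inter> Fpow K \<subseteq> Fpow posnats - F"
    using schreier_Ramsey_Fpow[OF inf_subsets_posnats[OF L(1)], of x F] by blast
  have K': "K \<in> inf_subsets M" "K \<subseteq> L" using K(1) L(1) by (auto simp: inf_subsets_def)
  have "\<not> schreier lam x \<inter> Fpow K \<subseteq> Fpow posnats - F"
  proof
    assume avoid: "schreier lam x \<inter> Fpow K \<subseteq> Fpow posnats - F"
    have "{} \<notin> scb_deriv K G (osuc x)"
    proof (rule empty_notin_scb_deriv)
      fix s assume "schreier_mem lam x s" "s \<subseteq> K"
      then show "s \<notin> G" using avoid schreier_mem_finite by (auto simp: schreier_def Fpow_def)
    qed (use hereditary_G inf_subsets_M[OF K'(1)] in auto)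
    then show False using ne scb_deriv_subset_mono[OF hereditary_G K'(2)] by blast
  qed
  then show ?thesis using K K'(1) by blast
qed

text \<open>All indices are at most \<open>x\<close>, so the derivative \<open>x\<close> is empty on
  every \<open>L\<close>. The Ramsey alternative of inclusion would keep \<open>{}\<close> in
  it.\<close>

lemma schreier_avoiding_if_sup_less:
  assumes "scb_sup M F < x + 1" "I \<in> inf_subsets M"
  shows "\<exists>L\<in>inf_subsets I. schreier lam x \<inter> Fpow L \<subseteq> Fpow posnats - F"
proof -
  obtain L where L: "L \<in> inf_subsets I"
    "schreier lam x \<inter> Fpow L \<subseteq> F \<or> schreier lam x \<inter> Fpow L \<subseteq> Fpow posnats - F"
    using schreier_Ramsey_Fpow[OF inf_subsets_posnats[OF assms(2)], of x F] by blast
  have L': "L \<in> inf_subsets M" using L(1) assms(2) by (auto simp: inf_subsets_def)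
  have "scb_index L G \<le> scb_sup M F"
    unfolding scb_sup_def by (rule cSUP_upper[OF L' bdd_above_scb_index])
  then have "scb_index L G \<le> x" using assms(1) by (simp add: oplus_one less_osuc_iff)
  then have "scb_deriv L G x = {}"
    using scb_deriv_antimono scb_deriv_scb_index[OF L'] by blast
  moreover have "{} \<in> scb_deriv L G x" if sub: "schreier lam x \<inter> Fpow L \<subseteq> F"
  proof (rule empty_in_scb_deriv)
    fix s assume "schreier_mem lam x s" "s \<subseteq> L"
    then show "s \<in> G" using sub schreier_mem_finite inf_subsets_M[OF L']
      by (auto simp: schreier_def Fpow_def)
  qed (use hereditary_G inf_subsets_M[OF L'] in auto)
  ultimately show ?thesis using L by blast
qed

end

theorem theoremB:
  fixes lam :: "omega1 \<Rightarrow> nat \<Rightarrow> omega1"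
  assumes "ladder_system lam"
  shows
    "(\<forall>F M. F \<subseteq> Fpow posnats \<and> hereditary F \<and> M \<in> inf_subsets posnats \<longrightarrow>
        (\<not> pointwise_closed (F \<inter> Fpow M) \<longrightarrow> (\<exists>L\<in>inf_subsets M. Fpow L \<subseteq> F)) \<and>
        (pointwise_closed (F \<inter> Fpow M) \<longrightarrow>
           (\<forall>L\<in>inf_subsets M. \<exists>\<xi>\<ge>1. scb_deriv L (F \<inter> Fpow M) \<xi> = {}) \<and>
           bdd_above ((\<lambda>L. scb_index L (F \<inter> Fpow M)) ` inf_subsets M) \<and>
           (\<forall>\<xi>.
              (scb_sup M F > \<xi> + 1 \<longrightarrow>
                 (\<exists>L\<in>inf_subsets M. schreier lam \<xi> \<inter> Fpow L \<subseteq> F)) \<and>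
              (scb_sup M F < \<xi> + 1 \<longrightarrow>
                 (\<forall>I\<in>inf_subsets M.
                    (\<exists>L\<in>inf_subsets I. schreier lam \<xi> \<inter> Fpow L \<subseteq> Fpow posnats - F) \<and>
                    (\<forall>L\<in>inf_subsets I.
                       schreier lam \<xi> \<inter> Fpow L \<subseteq> Fpow posnats - F \<longleftrightarrow>
                       F \<inter> Fpow L \<subseteq> star (schreier lam \<xi>) - schreier lam \<xi>))) \<and>
              (scb_sup M F = \<xi> + 1 \<longrightarrow>
                 (\<exists>L\<in>inf_subsets M.
                    schreier lam \<xi> \<inter> Fpow L \<subseteq> F \<or>
                    schreier lam \<xi> \<inter> Fpow L \<subseteq> Fpow posnats - F))))) \<and>
     (\<exists>F M \<xi>. F \<subseteq> Fpow posnats \<and> hereditary F \<and> M \<in> inf_subsets posnats \<and>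
        pointwise_closed (F \<inter> Fpow M) \<and> scb_sup M F = \<xi> + 1 \<and>
        (\<exists>L\<in>inf_subsets M. schreier lam \<xi> \<inter> Fpow L \<subseteq> F)) \<and>
     (\<exists>F M \<xi>. F \<subseteq> Fpow posnats \<and> hereditary F \<and> M \<in> inf_subsets posnats \<and>
        pointwise_closed (F \<inter> Fpow M) \<and> scb_sup M F = \<xi> + 1 \<and>
        (\<exists>L\<in>inf_subsets M. schreier lam \<xi> \<inter> Fpow L \<subseteq> Fpow posnats - F))"
proof -
  obtain sec where sec: "schreier_sections lam sec" using schreier_sections_ex[OF assms] ..
  interpret schreier_sections lam sec by (rule sec)
  have pos: "posnats \<in> inf_subsets posnats" by (simp add: inf_subsets_def infinite_Ici)
  have zero: "schreier lam 0 = {{}}" by (simp add: schreier_def)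
  show ?thesis
  proof (intro conjI allI impI; (elim conjE)?)
    fix F M assume F: "F \<subseteq> Fpow posnats" "hereditary F" and M: "M \<in> inf_subsets posnats"
    show "\<exists>L\<in>inf_subsets M. Fpow L \<subseteq> F" if "\<not> pointwise_closed (F \<inter> Fpow M)"
      using pointwise_not_closed_dichotomy F(2) that by blast
    assume closed: "pointwise_closed (F \<inter> Fpow M)"
    interpret closed_hereditary_trace lam sec F M
      by unfold_locales (use F M closed in auto)
    show "\<forall>L\<in>inf_subsets M. \<exists>\<xi>\<ge>1. scb_deriv L (F \<inter> Fpow M) \<xi> = {}"
      using scb_deriv_eventually_empty by blast
    show "bdd_above ((\<lambda>L. scb_index L (F \<inter> Fpow M)) ` inf_subsets M)"
      by (rule bdd_above_scb_index)
    fix x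
    show "\<exists>L\<in>inf_subsets M. schreier lam x \<inter> Fpow L \<subseteq> F" if "scb_sup M F > x + 1"
      by (rule schreier_subset_if_sup_greater[OF that])
    show "\<forall>I\<in>inf_subsets M.
        (\<exists>L\<in>inf_subsets I. schreier lam x \<inter> Fpow L \<subseteq> Fpow posnats - F) \<and>
        (\<forall>L\<in>inf_subsets I.
           schreier lam x \<inter> Fpow L \<subseteq> Fpow posnats - F \<longleftrightarrow>
           F \<inter> Fpow L \<subseteq> star (schreier lam x) - schreier lam x)"
      if "scb_sup M F < x + 1"
    proof (intro ballI conjI)
      fix I assume I: "I \<in> inf_subsets M"
      show "\<exists>L\<in>inf_subsets I. schreier lam x \<inter> Fpow L \<subseteq> Fpow posnats - F"
        by (rule schreier_avoiding_if_sup_less[OF that I])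
      fix L assume "L \<in> inf_subsets I"
      then have "infinite L" "L \<subseteq> posnats" using I M by (auto simp: inf_subsets_def)
      then show "schreier lam x \<inter> Fpow L \<subseteq> Fpow posnats - F \<longleftrightarrow>
          F \<inter> Fpow L \<subseteq> star (schreier lam x) - schreier lam x"
        by (rule schreier_avoiding_iff[OF F(2,1)])
    qed
    \<comment> \<open>At equality the derivative bounds do not decide between the alternatives; the
      Ramsey property supplies one of them.\<close>
    show "\<exists>L\<in>inf_subsets M. schreier lam x \<inter> Fpow L \<subseteq> F \<or>
        schreier lam x \<inter> Fpow L \<subseteq> Fpow posnats - F"
      by (rule schreier_Ramsey_Fpow[OF M])
  next
    show "\<exists>F M \<xi>. F \<subseteq> Fpow posnats \<and> hereditary F \<and> M \<in> inf_subsets posnats \<and>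
        pointwise_closed (F \<inter> Fpow M) \<and> scb_sup M F = \<xi> + 1 \<and>
        (\<exists>L\<in>inf_subsets M. schreier lam \<xi> \<inter> Fpow L \<subseteq> F)"
    \<comment> \<open>At \<xi> = 0 the Schreier family is \<open>{{}}\<close> itself. Choosing the
      same family for \<open>F\<close> gives inclusion with index 1.\<close>
    proof (intro exI[of _ "{{}}"] exI[of _ posnats] exI[of _ 0] conjI)
      show "scb_sup posnats {{}} = 0 + 1" by (rule scb_sup_eq_one[OF _ pos]) simp
      show "pointwise_closed ({{}} \<inter> Fpow posnats)"
        by (rule pointwise_closed_subset_singleton_empty) simp
      show "\<exists>L\<in>inf_subsets posnats. schreier lam 0 \<inter> Fpow L \<subseteq> {{}}"
        using pos zero empty_in_Fpow by blast
    qed (use pos in \<open>simp_all add: hereditary_def empty_in_Fpow\<close>)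
  next
    show "\<exists>F M \<xi>. F \<subseteq> Fpow posnats \<and> hereditary F \<and> M \<in> inf_subsets posnats \<and>
        pointwise_closed (F \<inter> Fpow M) \<and> scb_sup M F = \<xi> + 1 \<and>
        (\<exists>L\<in>inf_subsets M. schreier lam \<xi> \<inter> Fpow L \<subseteq> Fpow posnats - F)"
    \<comment> \<open>The empty family also has index 1, because indices start there, and it avoids
      everything.\<close>
    proof (intro exI[of _ "{} :: nat set set"] exI[of _ posnats] exI[of _ 0] conjI)
      show "scb_sup posnats {} = 0 + 1" by (rule scb_sup_eq_one[OF _ pos]) simp
      show "pointwise_closed ({} \<inter> Fpow posnats)"
        by (rule pointwise_closed_subset_singleton_empty) simp
      show "\<exists>L\<in>inf_subsets posnats. schreier lam 0 \<inter> Fpow L \<subseteq> Fpow posnats - {}"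
        using pos zero empty_in_Fpow by blast
    qed (use pos in \<open>simp_all add: hereditary_def empty_in_Fpow\<close>)
  qed
qed

end
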